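(* Fix $\alpha>0$ and let $X=\{(\lambda,m_\lambda)\}_{\lambda\in\Lambda}$ denote a divisor. (a) If $X$ is an interpolating divisor for $\mathcal F^\infty_\alpha$, then there exists $C=C(M_X)>0$ (depending only on the interpolation constant $M_X$) such that the discs $\{D(\lambda,\sqrt{m_\lambda/\alpha}-C)\}_{\lambda\in\Lambda,\ m_\lambda>\alpha C^2}$ are pairwise disjoint. (b) Conversely, there exists $C_0>0$ (independent of $X$) such that if the discs $\{D(\lambda,\sqrt{m_\lambda/\alpha}+C_0)\}_{\lambda\in\Lambda}$ are pairwise disjoint, then $X$ is an interpolating divisor for $\mathcal F^\infty_\alpha$.
   Context: $D(z,r)$ is the open disc of radius $r$ centered at $z\in\mathbb C$. For $\alpha>0$, $\mathcal F^\infty_\alpha$ is the Banach space of entire functions $f$ with $\|f\|_{\alpha,\infty}=\sup_{z\in\mathbb C}|f(z)|e^{-\frac{\alpha}{2}|z|^2}<\infty$. A divisor is $X=\{(\lambda,m_\lambda)\}_{\lambda\in\Lambda}$, where $\Lambda$ is a sequence of (distinct) points in $\mathbb C$ and $m_\lambda\in\{1,2,3,\dots\}$ is the multiplicity associated with $\lambda$. Put $N^\infty_\lambda=\{f\in\mathcal F^\infty_\alpha: f(\lambda)=f'(\lambda)=\dots=f^{(m_\lambda-1)}(\lambda)=0\}$, and let $\|f\|_{\mathcal F^\infty_\alpha/N^\infty_\lambda}=\inf_{g\in N^\infty_\lambda}\|f-g\|_{\alpha,\infty}$ be the quotient norm. $X$ is called interpolating for $\mathcal F^\infty_\alpha$ if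 for every family $(f_\lambda)_{\lambda\in\Lambda}\subset\mathcal F^\infty_\alpha$ with $\sup_{\lambda\in\Lambda}\|f_\lambda\|_{\mathcal F^\infty_\alpha/N^\infty_\lambda}<\infty$ there exists $f\in\mathcal F^\infty_\alpha$ such that $f-f_\lambda\in N^\infty_\lambda$ for all $\lambda\in\Lambda$. In that case, the interpolation constant $M_X$ is the minimal constant $C'$ such that one can always find such an interpolating $f$ with $\|f\|_{\alpha,\infty}\le C'\sup_{\lambda\in\Lambda}\|f_\lambda\|_{\mathcal F^\infty_\alpha/N^\infty_\lambda}$. *)

theory Defs
  imports "HOL-Complex_Analysis.Complex_Analysis"
begin

definition fock_space :: "real \<Rightarrow> (complex \<Rightarrow> complex) set" where
  "fock_space \<alpha> = {f. f holomorphic_on UNIV \<and>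
     bdd_above (range (\<lambda>z. norm (f z) * exp (- (\<alpha> / 2) * (norm z)\<^sup>2)))}"

definition fock_norm :: "real \<Rightarrow> (complex \<Rightarrow> complex) \<Rightarrow> real" where
  "fock_norm \<alpha> f = (SUP z. norm (f z) * exp (- (\<alpha> / 2) * (norm z)\<^sup>2))"

text \<open>A divisor is a set \<open>\<Lambda>\<close> of points together with a multiplicity function \<open>m\<close>, of which only
  the values on \<open>\<Lambda>\<close> matter. Finite (also empty) \<open>\<Lambda>\<close> are allowed; there is no
  assumption of local finiteness.\<close>

definition divisor :: "complex set \<Rightarrow> (complex \<Rightarrow> nat) \<Rightarrow> bool" where
  "divisor \<Lambda> m \<longleftrightarrow> countable \<Lambda> \<and> (\<forall>l\<in>\<Lambda>. 1 \<le> m l)"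

definition vanishing :: "real \<Rightarrow> complex \<Rightarrow> nat \<Rightarrow> (complex \<Rightarrow> complex) set" where
  "vanishing \<alpha> l k = {f \<in> fock_space \<alpha>. \<forall>j<k. (deriv ^^ j) f l = 0}"

definition quotient_norm :: "real \<Rightarrow> complex \<Rightarrow> nat \<Rightarrow> (complex \<Rightarrow> complex) \<Rightarrow> real" where
  "quotient_norm \<alpha> l k f = (INF g\<in>vanishing \<alpha> l k. fock_norm \<alpha> (\<lambda>z. f z - g z))"

definition admissible_data ::
  "real \<Rightarrow> complex set \<Rightarrow> (complex \<Rightarrow> nat) \<Rightarrow> (complex \<Rightarrow> complex \<Rightarrow> complex) \<Rightarrow> bool" where
  "admissible_data \<alpha> \<Lambda> m F \<longleftrightarrow> (\<forall>l\<in>\<Lambda>. F l \<in> fock_space \<alpha>) \<and>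
     bdd_above ((\<lambda>l. quotient_norm \<alpha> l (m l) (F l)) ` \<Lambda>)"

text \<open>Quotient norms are nonnegative, so inserting \<open>0\<close> changes the supremum only for empty
  \<open>\<Lambda>\<close>, where it gives the value \<open>0\<close>.\<close>

definition data_norm ::
  "real \<Rightarrow> complex set \<Rightarrow> (complex \<Rightarrow> nat) \<Rightarrow> (complex \<Rightarrow> complex \<Rightarrow> complex) \<Rightarrow> real" where
  "data_norm \<alpha> \<Lambda> m F = Sup (insert 0 ((\<lambda>l. quotient_norm \<alpha> l (m l) (F l)) ` \<Lambda>))"

definition interpolates ::
  "real \<Rightarrow> complex set \<Rightarrow> (complex \<Rightarrow> nat) \<Rightarrow> (complex \<Rightarrow> complex \<Rightarrow> complex) \<Rightarrow>
   (complex \<Rightarrow> complex) \<Rightarrow> bool" where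
  "interpolates \<alpha> \<Lambda> m F f \<longleftrightarrow> f \<in> fock_space \<alpha> \<and>
     (\<forall>l\<in>\<Lambda>. (\<lambda>z. f z - F l z) \<in> vanishing \<alpha> l (m l))"

definition interpolating :: "real \<Rightarrow> complex set \<Rightarrow> (complex \<Rightarrow> nat) \<Rightarrow> bool" where
  "interpolating \<alpha> \<Lambda> m \<longleftrightarrow> (\<forall>F. admissible_data \<alpha> \<Lambda> m F \<longrightarrow> (\<exists>f. interpolates \<alpha> \<Lambda> m F f))"

text \<open>For an interpolating divisor the set below is nonempty (open mapping theorem) and the
  infimum is attained (normal families), so this is the minimal constant. The bound
  \<open>0 \<le> K\<close> is only needed for empty \<open>\<Lambda>\<close>.\<close>

definition interpolation_constant :: "real \<Rightarrow> complex set \<Rightarrow> (complex \<Rightarrow> nat) \<Rightarrow> real" where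
  "interpolation_constant \<alpha> \<Lambda> m = Inf {K. 0 \<le> K \<and>
     (\<forall>F. admissible_data \<alpha> \<Lambda> m F \<longrightarrow>
        (\<exists>f. interpolates \<alpha> \<Lambda> m F f \<and> fock_norm \<alpha> f \<le> K * data_norm \<alpha> \<Lambda> m F))}"

end

theory Submission
  imports Defs
begin

text \<open>
  (a) By the maximum principle, a function of norm \<open>K\<close> vanishing to order \<open>n\<close> at \<open>l\<close> has weighted
  size \<open>norm (f z) * exp (- \<alpha> / 2 * (norm z)\<^sup>2)\<close> at most \<open>K exp (- \<alpha> c\<^sup>2 / 2)\<close> on the disc of
  radius \<open>sqrt (n / \<alpha>) - c\<close> around \<open>l\<close>. If two such discs share a point \<open>z\<close>, interpolate the normalised reproducing kernel at \<open>z\<close> to full order at one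
  centre and \<open>0\<close> at the other: the kernel has weighted size \<open>1\<close> at \<open>z\<close>, but both the interpolant and
  its difference from the kernel are small there. That some uniform interpolation constant exists is
  a gliding hump argument, in which normal families replace the open mapping theorem.

  (b) After rescaling to \<open>\<alpha> = 1\<close>, the jet of order \<open>m\<close> of \<open>g\<close> is represented by the average \<open>p\<close> of the
  Taylor polynomials of degrees \<open>m, \<dots>, m + G - 1\<close> with \<open>G = \<lceil>sqrt m\<rceil>\<close>. It splits into Fejer means
  over frequency blocks of width \<open>G\<close>. Each block is bounded on circles by \<open>g\<close> and has Gaussian decay
  away from the circle matching its frequencies, so \<open>p\<close> is controlled by \<open>g\<close> on a neighbourhood of
  the disc of radius \<open>sqrt m\<close> and decays outside that disc, uniformly in \<open>m\<close>. Adding these local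
  solutions over well separated discs interpolates up to an error of half the size
  of the data. Iterating over finite subsets and passing to a normal limit gives the interpolant.
\<close>

section \<open>Fock functions and vanishing orders\<close>

text \<open>Membership in \<open>fock_space\<close> and \<open>fock_norm \<alpha> f \<le> B\<close>
  in one pointwise condition, so that estimates need no boundedness side conditions for the
  supremum.\<close>

definition fock_le :: "real \<Rightarrow> real \<Rightarrow> (complex \<Rightarrow> complex) \<Rightarrow> bool" where
  "fock_le \<alpha> B f \<longleftrightarrow> f holomorphic_on UNIV \<and> (\<forall>z. norm (f z) \<le> B * exp (\<alpha> / 2 * (norm z)\<^sup>2))"

lemma fock_leI:
  assumes "f holomorphic_on UNIV" "\<And>z. norm (f z) \<le> B * exp (\<alpha> / 2 * (norm z)\<^sup>2)"
  shows "fock_le \<alpha> B f"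
  using assms by (simp add: fock_le_def)

lemma fock_le_holo: "fock_le \<alpha> B f \<Longrightarrow> f holomorphic_on UNIV"
  by (simp add: fock_le_def)

lemma fock_le_bound: "fock_le \<alpha> B f \<Longrightarrow> norm (f z) \<le> B * exp (\<alpha> / 2 * (norm z)\<^sup>2)"
  by (simp add: fock_le_def)

lemma fock_le_nonneg: "fock_le \<alpha> B f \<Longrightarrow> 0 \<le> B"
  using order_trans[OF norm_ge_zero fock_le_bound[of \<alpha> B f 0]] by simp

lemma fock_le_mono: "fock_le \<alpha> B f \<Longrightarrow> B \<le> B' \<Longrightarrow> fock_le \<alpha> B' f"
  unfolding fock_le_def by (meson exp_ge_zero mult_right_mono order_trans)

lemma fock_le_0 [simp]: "0 \<le> B \<Longrightarrow> fock_le \<alpha> B (\<lambda>z. 0)"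
  by (simp add: fock_le_def)

lemma fock_le_add:
  assumes "fock_le \<alpha> A f" "fock_le \<alpha> B g"
  shows "fock_le \<alpha> (A + B) (\<lambda>z. f z + g z)"
  using assms unfolding fock_le_def
  by (auto intro!: holomorphic_intros simp: distrib_right intro: norm_triangle_le add_mono)

lemma fock_le_cmult:
  assumes "fock_le \<alpha> A f"
  shows "fock_le \<alpha> (norm c * A) (\<lambda>z. c * f z)"
  using assms unfolding fock_le_def
  by (auto intro!: holomorphic_intros simp: norm_mult mult.assoc mult_left_mono)

lemma fock_le_minus:
  assumes "fock_le \<alpha> A f"
  shows "fock_le \<alpha> A (\<lambda>z. - f z)"
  using fock_le_cmult[OF assms, of "-1"] by simp

lemma fock_le_diff:
  assumes "fock_le \<alpha> A f" "fock_le \<alpha> B g"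
  shows "fock_le \<alpha> (A + B) (\<lambda>z. f z - g z)"
  using fock_le_add[OF assms(1) fock_le_minus[OF assms(2)]] by simp

lemma norm_weight_le_iff:
  fixes z :: complex
  shows "x * exp (- (\<alpha> / 2) * (norm z)\<^sup>2) \<le> B \<longleftrightarrow> x \<le> B * exp (\<alpha> / 2 * (norm z)\<^sup>2)"
  by (simp add: exp_minus field_simps)

lemma fock_space_fock_norm:
  assumes "f \<in> fock_space \<alpha>"
  shows "fock_le \<alpha> (fock_norm \<alpha> f) f"
proof (rule fock_leI)
  show "f holomorphic_on UNIV" using assms by (simp add: fock_space_def)
  fix z
  have "norm (f z) * exp (- (\<alpha> / 2) * (norm z)\<^sup>2) \<le> fock_norm \<alpha> f"
    using assms unfolding fock_space_def fock_norm_def by (auto intro: cSUP_upper)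
  then show "norm (f z) \<le> fock_norm \<alpha> f * exp (\<alpha> / 2 * (norm z)\<^sup>2)"
    unfolding norm_weight_le_iff .
qed

lemma fock_le_fock_space:
  assumes "fock_le \<alpha> B f"
  shows "f \<in> fock_space \<alpha>"
  unfolding fock_space_def
proof (intro CollectI conjI bdd_aboveI2)
  show "f holomorphic_on UNIV" using assms by (rule fock_le_holo)
  show "norm (f z) * exp (- (\<alpha> / 2) * (norm z)\<^sup>2) \<le> B" for z
    unfolding norm_weight_le_iff by (rule fock_le_bound[OF assms])
qed

lemma fock_norm_le:
  assumes "fock_le \<alpha> B f"
  shows "fock_norm \<alpha> f \<le> B"
  unfolding fock_norm_def
proof (rule cSUP_least)
  show "norm (f z) * exp (- (\<alpha> / 2) * (norm z)\<^sup>2) \<le> B" for z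
    unfolding norm_weight_le_iff by (rule fock_le_bound[OF assms])
qed auto

lemma fock_norm_nonneg: "f \<in> fock_space \<alpha> \<Longrightarrow> 0 \<le> fock_norm \<alpha> f"
  using fock_le_nonneg fock_space_fock_norm by blast

section \<open>Orders of vanishing\<close>

text \<open>Stated as a factorisation because the entire cofactor \<open>h\<close> is what the
  maximum principle is applied to later. \<open>vanishes_to_iff_deriv\<close> links it to the
  derivatives.\<close>

definition vanishes_to :: "(complex \<Rightarrow> complex) \<Rightarrow> complex \<Rightarrow> nat \<Rightarrow> bool" where
  "vanishes_to f l n \<longleftrightarrow> (\<exists>h. h holomorphic_on UNIV \<and> (\<forall>z. f z = (z - l) ^ n * h z))"

lemma vanishes_toI: "h holomorphic_on UNIV \<Longrightarrow> (\<And>z. f z = (z - l) ^ n * h z) \<Longrightarrow> vanishes_to f l n"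
  by (auto simp: vanishes_to_def)

lemma vanishes_to_0: "vanishes_to (\<lambda>z. 0) l n"
  by (rule vanishes_toI[of "\<lambda>z. 0"]) auto

lemma vanishes_to_add:
  assumes "vanishes_to f l n" "vanishes_to g l n"
  shows "vanishes_to (\<lambda>z. f z + g z) l n"
proof -
  obtain h k where "h holomorphic_on UNIV" "k holomorphic_on UNIV"
    "\<And>z. f z = (z - l) ^ n * h z" "\<And>z. g z = (z - l) ^ n * k z"
    using assms unfolding vanishes_to_def by blast
  then show ?thesis
    by (intro vanishes_toI[of "\<lambda>z. h z + k z"]) (auto intro!: holomorphic_intros simp: algebra_simps)
qed

lemma vanishes_to_cmult:
  assumes "vanishes_to f l n"
  shows "vanishes_to (\<lambda>z. c * f z) l n"
proof -
  obtain h where "h holomorphic_on UNIV" "\<And>z. f z = (z - l) ^ n * h z"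
    using assms unfolding vanishes_to_def by blast
  then show ?thesis
    by (intro vanishes_toI[of "\<lambda>z. c * h z"]) (auto intro!: holomorphic_intros simp: algebra_simps)
qed

lemma vanishes_to_diff:
  assumes "vanishes_to f l n" "vanishes_to g l n"
  shows "vanishes_to (\<lambda>z. f z - g z) l n"
  using vanishes_to_add[OF assms(1) vanishes_to_cmult[OF assms(2), of "-1"]] by simp

text \<open>The tail of the power series still converges everywhere after division by
  \<open>(z - l) ^ n\<close>, so its sum is entire.\<close>

lemma taylor_remainder_entire:
  assumes f: "f holomorphic_on UNIV"
  obtains h where "h holomorphic_on UNIV"
    "\<And>z. f z = (\<Sum>k<n. (deriv ^^ k) f l / fact k * (z - l) ^ k) + (z - l) ^ n * h z"
proof -
  define a where "a = (\<lambda>k. (deriv ^^ k) f l / fact k)"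
  have sums: "(\<lambda>k. a k * (z - l) ^ k) sums f z" for z
    unfolding a_def
    by (rule holomorphic_power_series[of f l "dist l z + 1"])
       (use f in \<open>auto intro: holomorphic_on_subset\<close>)
  define h where "h = (\<lambda>z. \<Sum>k. a (k + n) * (z - l) ^ k)"
  have split: "f z = (\<Sum>k<n. a k * (z - l) ^ k) + (\<Sum>k. a (k + n) * (z - l) ^ (k + n))" for z
    using suminf_split_initial_segment[of "\<lambda>k. a k * (z - l) ^ k" n] sums[of z]
    by (simp add: sums_iff)
  have summ: "summable (\<lambda>k. a (k + n) * (z - l) ^ k)" for z
  \<comment> \<open>The division by \<open>(z - l) ^ n\<close> fails only at the centre, where every
    term but the first is 0.\<close>
  proof (cases "z = l")
    case True
    then show ?thesis by (auto intro!: summable_finite[of "{0}"])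
  next
    case False
    have "summable (\<lambda>k. a (k + n) * (z - l) ^ (k + n))"
      using sums[of z] by (subst summable_iff_shift) (simp add: sums_iff)
    then have "summable (\<lambda>k. (a (k + n) * (z - l) ^ k) * (z - l) ^ n)"
      by (simp add: power_add mult.assoc)
    then have "summable (\<lambda>k. (a (k + n) * (z - l) ^ k) * (z - l) ^ n / (z - l) ^ n)"
      by (rule summable_divide)
    then show ?thesis using False by simp
  qed
  have h: "h holomorphic_on UNIV"
  proof -
    have "h holomorphic_on ball l (of_nat r)" for r :: nat
      using summ by (intro power_series_holomorphic[of l _ "\<lambda>k. a (k + n)"])
                     (auto simp: h_def summable_sums)
    then have "h holomorphic_on (\<Union>r::nat. ball l (of_nat r))"
      by (intro holomorphic_on_UN_open) auto
    also have "(\<Union>r::nat. ball l (of_nat r)) = UNIV"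
      by (auto simp: reals_Archimedean2)
    finally show ?thesis .
  qed
  have "(\<Sum>k. a (k + n) * (z - l) ^ (k + n)) = (z - l) ^ n * h z" for z
    unfolding h_def using suminf_mult[OF summ[of z], of "(z - l) ^ n"]
    by (simp add: power_add mult_ac)
  then have "f z = (\<Sum>k<n. (deriv ^^ k) f l / fact k * (z - l) ^ k) + (z - l) ^ n * h z" for z
    using split[of z] by (simp add: a_def)
  with h show ?thesis by (rule that)
qed

text \<open>Differentiation keeps the factorised shape and lowers the order by one, so the induction
  has to run over all \<open>f\<close> and \<open>n\<close>.\<close>

lemma vanishes_to_deriv_zero:
  assumes "vanishes_to f l n" "j < n"
  shows "(deriv ^^ j) f l = 0"
  using assms
proof (induction j arbitrary: f n)
  case 0
  then show ?case by (auto simp: vanishes_to_def)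
next
  case (Suc j)
  obtain n' where n: "n = Suc n'" using Suc.prems(2) by (cases n) auto
  obtain h where h: "h holomorphic_on UNIV" "\<And>z. f z = (z - l) ^ n * h z"
    using Suc.prems unfolding vanishes_to_def by blast
  have "deriv f z = (z - l) ^ n' * (of_nat n * h z + (z - l) * deriv h z)" for z
  proof -
    have dh: "(h has_field_derivative deriv h z) (at z)"
      using h(1) holomorphic_derivI by blast
    have dp: "((\<lambda>z. (z - l) ^ n) has_field_derivative of_nat n * (1 * (z - l) ^ (n - Suc 0))) (at z)"
      by (rule DERIV_power) (auto intro!: derivative_eq_intros)
    have "((\<lambda>z. (z - l) ^ n * h z) has_field_derivative
        (z - l) ^ n' * (of_nat n * h z + (z - l) * deriv h z)) (at z)"
      using DERIV_mult'[OF dp dh] by (simp add: n algebra_simps)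
    moreover have "(\<lambda>z. (z - l) ^ n * h z) = f" using h(2) by auto
    ultimately show ?thesis using DERIV_imp_deriv by metis
  qed
  then have "vanishes_to (deriv f) l n'"
    by (intro vanishes_toI[of "\<lambda>z. of_nat n * h z + (z - l) * deriv h z"])
       (use h(1) in \<open>auto intro!: holomorphic_intros\<close>)
  from Suc.IH[OF this] Suc.prems(2) n show ?case by (simp add: funpow_swap1)
qed

lemma vanishes_to_iff_deriv:
  assumes "f holomorphic_on UNIV"
  shows "vanishes_to f l n \<longleftrightarrow> (\<forall>j<n. (deriv ^^ j) f l = 0)"
proof
  assume z: "\<forall>j<n. (deriv ^^ j) f l = 0"
  obtain h where "h holomorphic_on UNIV"
    "\<And>z. f z = (\<Sum>k<n. (deriv ^^ k) f l / fact k * (z - l) ^ k) + (z - l) ^ n * h z"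
    using taylor_remainder_entire[OF assms] by blast
  with z show "vanishes_to f l n" by (auto intro!: vanishes_toI)
qed (use vanishes_to_deriv_zero in blast)

lemma vanishing_iff:
  "f \<in> vanishing \<alpha> l n \<longleftrightarrow> f \<in> fock_space \<alpha> \<and> vanishes_to f l n"
proof (cases "f \<in> fock_space \<alpha>")
  case True
  then have "f holomorphic_on UNIV" by (simp add: fock_space_def)
  from vanishes_to_iff_deriv[OF this] show ?thesis by (simp add: vanishing_def)
qed (simp add: vanishing_def)

section \<open>Quotient norms and representatives\<close>

text \<open>Subtracting a nearly optimal element of the infimum from \<open>f\<close> leaves a
  representative of the same jet. The inequality is strict because the infimum is not shown to be
  attained.\<close>

lemma quotient_norm_less:
  assumes "quotient_norm \<alpha> l n f < B" "f \<in> fock_space \<alpha>"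
  obtains g where "fock_le \<alpha> B g" "vanishes_to (\<lambda>z. f z - g z) l n"
proof -
  have ne: "vanishing \<alpha> l n \<noteq> {}"
    using vanishes_to_0 fock_le_0[of 0] fock_le_fock_space by (fastforce simp: vanishing_iff)
  have bdd: "bdd_below ((\<lambda>g. fock_norm \<alpha> (\<lambda>z. f z - g z)) ` vanishing \<alpha> l n)"
  proof (rule bdd_belowI2)
    fix g assume "g \<in> vanishing \<alpha> l n"
    then have "fock_le \<alpha> (fock_norm \<alpha> f + fock_norm \<alpha> g) (\<lambda>z. f z - g z)"
      using assms(2) by (intro fock_le_diff fock_space_fock_norm) (auto simp: vanishing_iff)
    then show "0 \<le> fock_norm \<alpha> (\<lambda>z. f z - g z)"
      using fock_norm_nonneg fock_le_fock_space by blast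
  qed
  obtain g where g: "g \<in> vanishing \<alpha> l n" "fock_norm \<alpha> (\<lambda>z. f z - g z) < B"
    using assms(1) ne bdd unfolding quotient_norm_def by (auto simp: cINF_less_iff)
  have "fock_le \<alpha> (fock_norm \<alpha> f + fock_norm \<alpha> g) (\<lambda>z. f z - g z)"
    using g(1) assms(2) by (intro fock_le_diff fock_space_fock_norm) (auto simp: vanishing_iff)
  then have "fock_le \<alpha> B (\<lambda>z. f z - g z)"
    using g(2) fock_le_mono fock_space_fock_norm fock_le_fock_space less_imp_le by meson
  moreover have "vanishes_to (\<lambda>z. f z - (f z - g z)) l n"
    using g(1) by (simp add: vanishing_iff)
  ultimately show ?thesis using that by blast
qed

lemma quotient_norm_le:
  assumes "fock_le \<alpha> B f"
  shows "quotient_norm \<alpha> l n f \<le> B"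
proof -
  have z: "(\<lambda>z. 0) \<in> vanishing \<alpha> l n"
    using vanishes_to_0 fock_le_0[of 0] fock_le_fock_space by (fastforce simp: vanishing_iff)
  have "0 \<le> fock_norm \<alpha> (\<lambda>z. f z - g z)" if "g \<in> vanishing \<alpha> l n" for g
  proof -
    have "fock_le \<alpha> (B + fock_norm \<alpha> g) (\<lambda>z. f z - g z)"
      using that assms by (intro fock_le_diff fock_space_fock_norm) (auto simp: vanishing_iff)
    then show ?thesis using fock_norm_nonneg fock_le_fock_space by blast
  qed
  then have bdd: "bdd_below ((\<lambda>g. fock_norm \<alpha> (\<lambda>z. f z - g z)) ` vanishing \<alpha> l n)"
    by (rule bdd_belowI2)
  have "quotient_norm \<alpha> l n f \<le> fock_norm \<alpha> (\<lambda>z. f z - 0)"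
    unfolding quotient_norm_def by (rule cINF_lower[OF bdd z])
  also have "\<dots> \<le> B" using fock_norm_le[OF assms] by simp
  finally show "quotient_norm \<alpha> l n f \<le> B" .
qed

section \<open>Gaussian bounds and Fejer blocks\<close>

text \<open>Raise \<open>x \<le> exp (x - 1)\<close>, with \<open>x = t / sqrt N\<close>, to the
  power \<open>N\<close> and complete the square. In other words,
  \<open>t ^ N * exp (- t\<^sup>2 / 2)\<close> has Gaussian decay away from its maximum at
  \<open>t = sqrt N\<close>.\<close>

lemma gauss_power_bound:
  fixes t :: real and N :: nat
  assumes "0 \<le> t" "1 \<le> N"
  shows "(t / sqrt N) ^ N * exp (N / 2) \<le> exp (t\<^sup>2 / 2 - (t - sqrt N)\<^sup>2 / 2)"
proof -
  have "t / sqrt N \<le> exp (t / sqrt N - 1)"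
    using exp_ge_add_one_self[of "t / sqrt N - 1"] by simp
  then have "(t / sqrt N) ^ N \<le> exp (t / sqrt N - 1) ^ N"
    using assms by (intro power_mono) auto
  also have "\<dots> = exp (real N * (t / sqrt N - 1))"
    by (simp add: exp_of_nat_mult)
  also have "real N * (t / sqrt N - 1) = sqrt N * t - N"
    using assms(2) by (simp add: field_simps real_divide_square_eq)
  finally have "(t / sqrt N) ^ N * exp (N / 2) \<le> exp (sqrt N * t - N) * exp (N / 2)"
    by (rule mult_right_mono) simp
  also have "\<dots> = exp (t\<^sup>2 / 2 - (t - sqrt N)\<^sup>2 / 2)"
    by (simp add: exp_add[symmetric] power2_diff field_simps)
  finally show ?thesis .
qed

text \<open>The Schwarz lemma of order \<open>n\<close>: the maximum principle for
  \<open>f w / w ^ n\<close>.\<close>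

lemma norm_le_inside_circle:
  assumes f: "vanishes_to f 0 n" and "0 < \<rho>"
    and bound: "\<And>u. norm u = \<rho> \<Longrightarrow> norm (f u) \<le> B"
    and w: "norm w \<le> \<rho>"
  shows "norm (f w) \<le> (norm w / \<rho>) ^ n * B"
proof -
  obtain h where h: "h holomorphic_on UNIV" "\<And>z. f z = z ^ n * h z"
    using f unfolding vanishes_to_def by auto
  have "norm (h w) \<le> B / \<rho> ^ n"
  proof (rule maximum_modulus_frontier[of h "cball 0 \<rho>"])
    show "h holomorphic_on interior (cball 0 \<rho>)" "continuous_on (closure (cball 0 \<rho>)) h"
      using h(1) by (auto intro: holomorphic_on_subset holomorphic_on_imp_continuous_on continuous_on_subset)
    show "norm (h z) \<le> B / \<rho> ^ n" if "z \<in> frontier (cball 0 \<rho>)" for z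
    proof -
      have "norm z = \<rho>" using that by simp
      then show ?thesis
        using bound[of z] h(2)[of z] \<open>0 < \<rho>\<close> by (simp add: norm_mult norm_power field_simps)
    qed
  qed (use w in auto)
  then have "norm w ^ n * norm (h w) \<le> norm w ^ n * (B / \<rho> ^ n)"
    by (intro mult_left_mono) auto
  then show ?thesis
    using h(2)[of w] by (simp add: norm_mult norm_power power_divide)
qed

text \<open>Mirror image of the previous lemma: the reversed polynomial \<open>Q\<close> has no pole
  at 0, and the maximum principle applies to it on the disc of radius \<open>inverse \<rho>\<close>.
  Exponents may repeat over \<open>I\<close>, so that the double sum of a Fejer block fits
  directly.\<close>

lemma norm_le_outside_circle:
  fixes c :: "'a \<Rightarrow> complex" and e :: "'a \<Rightarrow> nat"
  assumes e: "\<And>i. i \<in> I \<Longrightarrow> e i \<le> N" and "0 < \<rho>"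
    and bound: "\<And>u. norm u = \<rho> \<Longrightarrow> norm (\<Sum>i\<in>I. c i * u ^ e i) \<le> B"
    and w: "\<rho> \<le> norm w"
  shows "norm (\<Sum>i\<in>I. c i * w ^ e i) \<le> (norm w / \<rho>) ^ N * B"
proof -
  define Q where "Q = (\<lambda>u. \<Sum>i\<in>I. c i * u ^ (N - e i))"
  have Q: "(\<Sum>i\<in>I. c i * u ^ e i) = u ^ N * Q (inverse u)" if "u \<noteq> 0" for u
    unfolding Q_def sum_distrib_left
    by (rule sum.cong) (use e that in \<open>auto simp: power_inverse power_diff\<close>)
  have "norm (Q (inverse w)) \<le> B / \<rho> ^ N"
  proof (rule maximum_modulus_frontier[of Q "cball 0 (inverse \<rho>)"])
    have "Q holomorphic_on UNIV" unfolding Q_def by (intro holomorphic_intros)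
    then show "Q holomorphic_on interior (cball 0 (inverse \<rho>))"
        "continuous_on (closure (cball 0 (inverse \<rho>))) Q"
      by (auto intro: holomorphic_on_subset holomorphic_on_imp_continuous_on continuous_on_subset)
    show "norm (Q z) \<le> B / \<rho> ^ N" if "z \<in> frontier (cball 0 (inverse \<rho>))" for z
    proof -
      have "norm (inverse z) = \<rho>" "z \<noteq> 0" using that \<open>0 < \<rho>\<close> by (auto simp: norm_inverse)
      have "norm (\<Sum>i\<in>I. c i * inverse z ^ e i) = \<rho> ^ N * norm (Q z)"
        using Q[of "inverse z"] \<open>norm (inverse z) = \<rho>\<close> \<open>z \<noteq> 0\<close>
        by (simp only: norm_mult norm_power inverse_inverse_eq inverse_nonzero_iff_nonzero not_False_eq_True simp_thms)
      with bound[OF \<open>norm (inverse z) = \<rho>\<close>] show ?thesis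
        using \<open>0 < \<rho>\<close> by (simp add: field_simps)
    qed
    show "inverse w \<in> cball 0 (inverse \<rho>)"
      using w \<open>0 < \<rho>\<close> by (auto simp: norm_inverse intro!: le_imp_inverse_le)
  qed auto
  then have "norm w ^ N * norm (Q (inverse w)) \<le> norm w ^ N * (B / \<rho> ^ N)"
    by (intro mult_left_mono) auto
  moreover have "w \<noteq> 0" using w \<open>0 < \<rho>\<close> by auto
  ultimately show ?thesis
    using Q[of w] by (simp add: norm_mult norm_power power_divide)
qed

text \<open>The weighted monomial of degree \<open>n\<close> peaks on the circle of radius
  \<open>sqrt n\<close>, so a bound on that circle alone propagates inwards with Gaussian
  decay.\<close>

lemma gauss_bound_inside:
  assumes f: "vanishes_to f 0 n" "1 \<le> n"
    and bound: "\<And>u. norm u = sqrt n \<Longrightarrow> norm (f u) \<le> B * exp ((norm u)\<^sup>2 / 2)"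
    and w: "norm w \<le> sqrt n"
  shows "norm (f w) \<le> B * exp ((norm w)\<^sup>2 / 2 - (norm w - sqrt n)\<^sup>2 / 2)"
proof -
  \<comment> \<open>The bound at one point of the circle forces \<open>0 \<le> B\<close>.\<close>
  have "norm (f (of_real (sqrt n))) \<le> B * exp (n / 2)"
    using bound[of "of_real (sqrt n)"] by simp
  then have "0 \<le> B * exp (n / 2)"
    by (rule order_trans[OF norm_ge_zero])
  then have B: "0 \<le> B" by (simp add: zero_le_mult_iff)
  have "norm (f w) \<le> (norm w / sqrt n) ^ n * (B * exp (n / 2))"
    by (rule norm_le_inside_circle) (use f bound w in auto)
  also have "\<dots> = B * ((norm w / sqrt n) ^ n * exp (n / 2))" by simp
  also have "\<dots> \<le> B * exp ((norm w)\<^sup>2 / 2 - (norm w - sqrt n)\<^sup>2 / 2)"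
    using f(2) B by (intro mult_left_mono gauss_power_bound) auto
  finally show ?thesis .
qed

text \<open>The outward counterpart, with degree at most \<open>N\<close> in place of a zero of
  order \<open>n\<close>.\<close>

lemma gauss_bound_outside:
  fixes c :: "'a \<Rightarrow> complex" and e :: "'a \<Rightarrow> nat"
  assumes e: "\<And>i. i \<in> I \<Longrightarrow> e i \<le> N" and N: "1 \<le> N"
    and bound: "\<And>u. norm u = sqrt N \<Longrightarrow> norm (\<Sum>i\<in>I. c i * u ^ e i) \<le> B * exp ((norm u)\<^sup>2 / 2)"
    and w: "sqrt N \<le> norm w"
  shows "norm (\<Sum>i\<in>I. c i * w ^ e i) \<le> B * exp ((norm w)\<^sup>2 / 2 - (norm w - sqrt N)\<^sup>2 / 2)"
proof -
  have "norm (\<Sum>i\<in>I. c i * of_real (sqrt N) ^ e i) \<le> B * exp (N / 2)"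
    using bound[of "of_real (sqrt N)"] by simp
  then have "0 \<le> B * exp (N / 2)"
    by (rule order_trans[OF norm_ge_zero])
  then have B: "0 \<le> B" by (simp add: zero_le_mult_iff)
  have "norm (\<Sum>i\<in>I. c i * w ^ e i) \<le> (norm w / sqrt N) ^ N * (B * exp (N / 2))"
  proof (rule norm_le_outside_circle[OF e])
    show "norm (\<Sum>i\<in>I. c i * u ^ e i) \<le> B * exp (N / 2)" if "norm u = sqrt N" for u
      using bound[OF that] that by simp
  qed (use N w in auto)
  also have "\<dots> = B * ((norm w / sqrt N) ^ N * exp (N / 2))" by simp
  also have "\<dots> \<le> B * exp ((norm w)\<^sup>2 / 2 - (norm w - sqrt N)\<^sup>2 / 2)"
    using N B by (intro mult_left_mono gauss_power_bound) auto
  finally show ?thesis .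
qed

section \<open>Fourier coefficients on circles and Fejer means\<close>

text \<open>Extended by 0 to negative indices, these give the Fourier coefficients of
  \<open>g\<close> on circles, so that frequency blocks may reach below 0.\<close>

definition taylor_coeff :: "(complex \<Rightarrow> complex) \<Rightarrow> int \<Rightarrow> complex" where
  "taylor_coeff g k = (if 0 \<le> k then (deriv ^^ nat k) g 0 / fact (nat k) else 0)"

text \<open>Cauchy's formulas on the unit circle for \<open>h u = g (w * u)\<close>. Scaling the
  function instead of the circle covers \<open>w = 0\<close> as well.\<close>

lemma has_integral_circle_coeff:
  assumes g: "g holomorphic_on UNIV"
  shows "((\<lambda>t. g (w * cis (2 * pi * t)) * cis (- 2 * pi * of_int k * t)) has_integral
            taylor_coeff g k * w ^ nat k) {0..1}"
proof -
  define h where "h = (\<lambda>u. g (w * u))"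
  have h: "h holomorphic_on UNIV"
    unfolding h_def by (rule holomorphic_on_compose_gen[OF _ g, unfolded o_def]) (auto intro!: holomorphic_intros)
  have circ: "circlepath 0 1 t = cis (2 * pi * t)" for t
    by (simp add: circlepath cis_conv_exp mult_ac)
  have vd: "vector_derivative (circlepath 0 1) (at t within {0..1}) = 2 * pi * \<i> * cis (2 * pi * t)"
    if "t \<in> {0..1}" for t
    using that by (simp add: vector_derivative_circlepath01 cis_conv_exp mult_ac)
  \<comment> \<open>The derivative of the path supplies one factor \<open>cis (2 * pi * t)\<close>,
    which is why the powers of \<open>u\<close> below are shifted by one.\<close>
  have *: "((\<lambda>t. F (cis (2 * pi * t)) * cis (2 * pi * t)) has_integral I / (2 * pi * \<i>)) {0..1}"
    if "(F has_contour_integral I) (circlepath 0 1)" for F I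
  proof -
    have "((\<lambda>t. F (cis (2 * pi * t)) * (2 * pi * \<i> * cis (2 * pi * t))) has_integral I) {0..1}"
      using that unfolding has_contour_integral_def
      by (rule has_integral_eq[rotated]) (simp add: circ vd)
    from has_integral_mult_right[OF this, of "1 / (2 * pi * \<i>)"] show ?thesis
      by (simp add: field_simps)
  qed
  show ?thesis
  proof (cases "0 \<le> k")
    case True
    then obtain n where k: "k = int n" using nonneg_int_cases by blast
    have "((\<lambda>u. h u / (u - 0) ^ Suc n) has_contour_integral
        ((2 * pi * \<i>) / (fact n) * (deriv ^^ n) h 0)) (circlepath 0 1)"
      by (rule Cauchy_has_contour_integral_higher_derivative_circlepath)
         (use h in \<open>auto intro: holomorphic_on_subset holomorphic_on_imp_continuous_on continuous_on_subset\<close>)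
    from *[OF this] have 1: "((\<lambda>t. h (cis (2 * pi * t)) / cis (2 * pi * t) ^ Suc n * cis (2 * pi * t))
        has_integral (deriv ^^ n) h 0 / fact n) {0..1}" by simp
    have 2: "(deriv ^^ n) h 0 = w ^ n * (deriv ^^ n) g 0"
      unfolding h_def using higher_deriv_compose_linear[OF g open_UNIV open_UNIV, of 0 w n] by simp
    have 3: "h (cis (2 * pi * t)) / cis (2 * pi * t) ^ Suc n * cis (2 * pi * t) =
        g (w * cis (2 * pi * t)) * cis (- 2 * pi * of_int k * t)" for t
    proof -
      have "cis (- 2 * pi * of_int k * t) = inverse (cis (2 * pi * t) ^ n)"
        unfolding k Complex.DeMoivre cis_inverse by (simp add: mult_ac)
      then show ?thesis by (simp add: h_def field_simps)
    qed
    show ?thesis using 1 unfolding 2 3 by (simp add: k taylor_coeff_def mult_ac)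
  next
    case False
    then obtain n where k: "k = - int (Suc n)"
      by (metis int_cases nonneg_int_cases not_le_imp_less of_nat_0_le_iff)
    have "((\<lambda>u. h u * u ^ n) has_contour_integral 0) (circlepath 0 1)"
      by (rule Cauchy_theorem_disc_simple[of _ 0 2])
         (use h in \<open>auto intro!: holomorphic_intros intro: holomorphic_on_subset\<close>)
    from *[OF this] have 1: "((\<lambda>t. h (cis (2 * pi * t)) * cis (2 * pi * t) ^ n * cis (2 * pi * t))
        has_integral 0) {0..1}" by simp
    have 3: "h (cis (2 * pi * t)) * cis (2 * pi * t) ^ n * cis (2 * pi * t) =
        g (w * cis (2 * pi * t)) * cis (- 2 * pi * of_int k * t)" for t
    proof -
      have "cis (- 2 * pi * of_int k * t) = cis (2 * pi * t) ^ Suc n"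
        unfolding k Complex.DeMoivre by (intro arg_cong[of _ _ cis]) (simp add: algebra_simps)
      then show ?thesis by (simp add: h_def)
    qed
    show ?thesis using 1 False unfolding 3 by (simp add: taylor_coeff_def)
  qed
qed

text \<open>The difference \<open>d = a - b\<close> occurs \<open>G - |d|\<close> times, so the
  coefficient at frequency \<open>c + d\<close> carries the Fejer weight \<open>1 - |d| / G\<close>.
  The double sum exhibits the kernel as a squared modulus.\<close>

definition fejer_block :: "(complex \<Rightarrow> complex) \<Rightarrow> nat \<Rightarrow> int \<Rightarrow> complex \<Rightarrow> complex" where
  "fejer_block g G c w = (\<Sum>(a, b)\<in>{..<G} \<times> {..<G}.
     (taylor_coeff g (c + int a - int b) / of_nat G) * w ^ nat (c + int a - int b))"

lemma cis_double_sum: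
  "(\<Sum>(a, b)\<in>{..<G} \<times> {..<G}. cis (- 2 * pi * of_int (c + int a - int b) * t)) =
     cis (- 2 * pi * of_int c * t) * of_real ((norm (\<Sum>a<G. cis (2 * pi * real a * t)))\<^sup>2)"
proof -
  have "(\<Sum>(a, b)\<in>{..<G} \<times> {..<G}. cis (- 2 * pi * of_int (c + int a - int b) * t)) =
      (\<Sum>(a, b)\<in>{..<G} \<times> {..<G}. cis (- 2 * pi * of_int c * t) *
         (cnj (cis (2 * pi * real a * t)) * cis (2 * pi * real b * t)))"
    by (intro sum.cong) (auto simp: cis_cnj cis_mult algebra_simps)
  also have "\<dots> = cis (- 2 * pi * of_int c * t) *
      ((\<Sum>a<G. cnj (cis (2 * pi * real a * t))) * (\<Sum>b<G. cis (2 * pi * real b * t)))"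
    by (simp only: sum_product sum.cartesian_product) (simp only: sum_distrib_left case_prod_unfold)
  also have "(\<Sum>a<G. cnj (cis (2 * pi * real a * t))) * (\<Sum>b<G. cis (2 * pi * real b * t)) =
      of_real ((norm (\<Sum>a<G. cis (2 * pi * real a * t)))\<^sup>2)"
    by (simp only: complex_norm_square cnj_sum mult.commute)
  finally show ?thesis .
qed

text \<open>Only the \<open>G\<close> diagonal pairs \<open>a = b\<close> survive the
  integration.\<close>

lemma fejer_kernel_integral:
  "((\<lambda>t. (norm (\<Sum>a<G. cis (2 * pi * real a * t)))\<^sup>2) has_integral real G) {0..1}"
proof -
  \<comment> \<open>Orthogonality of the characters, read off from the Fourier coefficients of the
    constant function 1.\<close>
  have 1: "((\<lambda>t. cis (- 2 * pi * of_int k * t)) has_integral (if k = 0 then 1 else 0)) {0..1}" for k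
  proof -
    have "(deriv ^^ n) (\<lambda>z::complex. 1 :: complex) 0 = (if n = 0 then 1 else 0)" for n
      by (simp add: higher_deriv_const)
    then have "taylor_coeff (\<lambda>z. 1) k * 1 ^ nat k = (if k = 0 then 1 else 0)"
      by (auto simp: taylor_coeff_def)
    with has_integral_circle_coeff[of "\<lambda>z. 1" 1 k] show ?thesis by simp
  qed
  have "((\<lambda>t. \<Sum>(a, b)\<in>{..<G} \<times> {..<G}. cis (- 2 * pi * of_int (0 + int a - int b) * t)) has_integral
      (\<Sum>(a, b)\<in>{..<G} \<times> {..<G}. if 0 + int a - int b = 0 then 1 else 0)) {0..1}"
    unfolding case_prod_unfold by (intro has_integral_sum 1) auto
  also have "(\<Sum>(a, b)\<in>{..<G} \<times> {..<G}. if 0 + int a - int b = 0 then 1 else 0 :: complex) = of_nat G"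
    by (simp add: sum.cartesian_product[symmetric] sum.delta')
  finally have "((\<lambda>t. of_real ((norm (\<Sum>a<G. cis (2 * pi * real a * t)))\<^sup>2)) has_integral
      complex_of_nat G) {0..1}"
    unfolding cis_double_sum by simp
  from has_integral_Re[OF this] show ?thesis by simp
qed

text \<open>The block averages \<open>g\<close> over the circle against a modulated Fejer kernel,
  which has a nonnegative modulus of mean 1 after division by \<open>G\<close>. Hence the bound
  passes without loss, where a sharp cut-off would cost a logarithm.\<close>

lemma fejer_block_circle_bound:
  assumes g: "g holomorphic_on UNIV" and "1 \<le> G"
    and bound: "\<And>u. norm u = norm w \<Longrightarrow> norm (g u) \<le> M"
  shows "norm (fejer_block g G c w) \<le> M"
proof -
  define S where "S = (\<lambda>t. (norm (\<Sum>a<G. cis (2 * pi * real a * t)))\<^sup>2)"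
  define \<phi> where "\<phi> = (\<lambda>t. g (w * cis (2 * pi * t)) * (cis (- 2 * pi * of_int c * t) * of_real (S t)))"
  have "((\<lambda>t. \<Sum>(a, b)\<in>{..<G} \<times> {..<G}.
           g (w * cis (2 * pi * t)) * cis (- 2 * pi * of_int (c + int a - int b) * t)) has_integral
      (\<Sum>(a, b)\<in>{..<G} \<times> {..<G}. taylor_coeff g (c + int a - int b) * w ^ nat (c + int a - int b))) {0..1}"
    unfolding case_prod_unfold by (intro has_integral_sum has_integral_circle_coeff[OF g]) auto
  also have "(\<lambda>t. \<Sum>(a, b)\<in>{..<G} \<times> {..<G}.
           g (w * cis (2 * pi * t)) * cis (- 2 * pi * of_int (c + int a - int b) * t)) = \<phi>"
    unfolding \<phi>_def S_def cis_double_sum[symmetric] sum_distrib_left case_prod_unfold ..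
  also have "(\<Sum>(a, b)\<in>{..<G} \<times> {..<G}. taylor_coeff g (c + int a - int b) * w ^ nat (c + int a - int b))
      = of_nat G * fejer_block g G c w"
    using \<open>1 \<le> G\<close> unfolding fejer_block_def sum_distrib_left by (intro sum.cong) auto
  finally have int: "(\<phi> has_integral of_nat G * fejer_block g G c w) {0..1}" .
  have S: "((\<lambda>t. M * S t) has_integral M * real G) {0..1}"
    unfolding S_def by (intro has_integral_mult_right fejer_kernel_integral)
  have "norm (integral {0..1} \<phi>) \<le> integral {0..1} (\<lambda>t. M * S t)"
  proof (rule integral_norm_bound_integral)
    fix t :: real
    have "0 \<le> S t" by (simp add: S_def)
    moreover have "norm (g (w * cis (2 * pi * t))) \<le> M" by (rule bound) (simp add: norm_mult)
    ultimately show "norm (\<phi> t) \<le> M * S t"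
      unfolding \<phi>_def by (simp add: norm_mult mult_right_mono)
  qed (use int S in auto)
  then have "real G * norm (fejer_block g G c w) \<le> real G * M"
    unfolding integral_unique[OF int] integral_unique[OF S] by (simp add: norm_mult mult.commute)
  then show ?thesis using \<open>1 \<le> G\<close> by simp
qed

lemma fejer_block_eq_0:
  assumes "c + int G \<le> 0"
  shows "fejer_block g G c w = 0"
  unfolding fejer_block_def using assms by (intro sum.neutral) (auto simp: taylor_coeff_def)

lemma fejer_block_vanishes:
  assumes "int n \<le> c - int G"
  shows "vanishes_to (fejer_block g G c) 0 n"
proof (rule vanishes_toI)
  show "(\<lambda>w. \<Sum>(a, b)\<in>{..<G} \<times> {..<G}.
     (taylor_coeff g (c + int a - int b) / of_nat G) * w ^ (nat (c + int a - int b) - n)) holomorphic_on UNIV"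
    by (auto intro!: holomorphic_intros simp: case_prod_unfold)
  show "fejer_block g G c z = (z - 0) ^ n * (\<Sum>(a, b)\<in>{..<G} \<times> {..<G}.
     (taylor_coeff g (c + int a - int b) / of_nat G) * z ^ (nat (c + int a - int b) - n))" for z
    unfolding fejer_block_def sum_distrib_left
  proof (rule sum.cong[OF refl])
    fix p assume "p \<in> {..<G} \<times> {..<G}"
    then have "n \<le> nat (c + int (fst p) - int (snd p))" using assms by auto
    then have "z ^ nat (c + int (fst p) - int (snd p)) = z ^ n * z ^ (nat (c + int (fst p) - int (snd p)) - n)"
      by (simp add: power_add[symmetric])
    then show "(case p of (a, b) \<Rightarrow> taylor_coeff g (c + int a - int b) / of_nat G * z ^ nat (c + int a - int b)) =
        (z - 0) ^ n * (case p of (a, b) \<Rightarrow>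
          taylor_coeff g (c + int a - int b) / of_nat G * z ^ (nat (c + int a - int b) - n))"
      by (simp add: case_prod_unfold mult_ac)
  qed
qed

text \<open>The frequencies lie strictly between \<open>c - G\<close> and \<open>c + G\<close>: the
  degree gives decay outside, the zero at 0 gives decay inside, and the circle bound serves in
  between. The conditions on \<open>R\<close> keep the circles used where \<open>g\<close> is
  controlled.\<close>

lemma fejer_block_bounds:
  assumes g: "g holomorphic_on UNIV" and G: "1 \<le> G"
    and bound: "\<And>u. norm u \<le> R \<Longrightarrow> norm (g u) \<le> \<epsilon> * exp ((norm u)\<^sup>2 / 2)"
  shows "norm w \<le> R \<Longrightarrow> norm (fejer_block g G c w) \<le> \<epsilon> * exp ((norm w)\<^sup>2 / 2)" (is "_ \<Longrightarrow> ?A w")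
    and "\<lbrakk>1 \<le> N; N = c + int G; sqrt N \<le> R; sqrt N \<le> norm w\<rbrakk> \<Longrightarrow>
       norm (fejer_block g G c w) \<le> \<epsilon> * exp ((norm w)\<^sup>2 / 2 - (norm w - sqrt N)\<^sup>2 / 2)"
    and "\<lbrakk>1 \<le> n; n = c - int G; sqrt n \<le> R; norm w \<le> sqrt n\<rbrakk> \<Longrightarrow>
       norm (fejer_block g G c w) \<le> \<epsilon> * exp ((norm w)\<^sup>2 / 2 - (norm w - sqrt n)\<^sup>2 / 2)"
proof -
  have *: "?A w" if w: "norm w \<le> R" for w
  proof (rule fejer_block_circle_bound[OF g G])
    show "norm (g u) \<le> \<epsilon> * exp ((norm w)\<^sup>2 / 2)" if "norm u = norm w" for u
      using bound[of u] that w by simp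
  qed
  then show "?A w" if "norm w \<le> R" using that .
  show "norm (fejer_block g G c w) \<le> \<epsilon> * exp ((norm w)\<^sup>2 / 2 - (norm w - sqrt N)\<^sup>2 / 2)"
    if N: "1 \<le> N" "N = c + int G" "sqrt N \<le> R" "sqrt N \<le> norm w"
  proof -
    obtain N' where N': "N = int N'" using N(1) by (metis nonneg_int_cases order_trans zero_le_one)
    have "norm (fejer_block g G c w) \<le>
        \<epsilon> * exp ((norm w)\<^sup>2 / 2 - (norm w - sqrt N')\<^sup>2 / 2)"
      unfolding fejer_block_def case_prod_unfold
    proof (rule gauss_bound_outside)
      fix u :: complex assume "norm u = sqrt N'"
      then have "?A u" using N(3) by (intro *) (simp add: N')
      then show "norm (\<Sum>p\<in>{..<G} \<times> {..<G}. taylor_coeff g (c + int (fst p) - int (snd p)) / of_nat G *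
          u ^ nat (c + int (fst p) - int (snd p))) \<le> \<epsilon> * exp ((norm u)\<^sup>2 / 2)"
        unfolding fejer_block_def case_prod_unfold .
    next
      show "sqrt N' \<le> norm w" using N(4) by (simp add: N')
    qed (use N(1,2) N' in auto)
    then show ?thesis by (simp add: N')
  qed
  show "norm (fejer_block g G c w) \<le> \<epsilon> * exp ((norm w)\<^sup>2 / 2 - (norm w - sqrt n)\<^sup>2 / 2)"
    if n: "1 \<le> n" "n = c - int G" "sqrt n \<le> R" "norm w \<le> sqrt n"
  proof -
    obtain n' where n': "n = int n'" using n(1) by (metis nonneg_int_cases order_trans zero_le_one)
    have "norm (fejer_block g G c w) \<le>
        \<epsilon> * exp ((norm w)\<^sup>2 / 2 - (norm w - sqrt n')\<^sup>2 / 2)"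
    proof (rule gauss_bound_inside)
      show "vanishes_to (fejer_block g G c) 0 n'" using n(2) n' by (intro fejer_block_vanishes) simp
      show "?A u" if "norm u = sqrt n'" for u using that n(3) by (intro *) (simp add: n')
      show "norm w \<le> sqrt n'" using n(4) by (simp add: n')
    qed (use n(1) n' in auto)
    then show ?thesis by (simp add: n')
  qed
qed

text \<open>For fixed \<open>a\<close>, the pairs of \<open>j\<close> and \<open>b\<close> run once
  through consecutive frequencies from \<open>m + a\<close> downwards. So the blocks add up to the
  average over \<open>a < G\<close> of the Taylor polynomials of degree \<open>m + a\<close>, each
  of which has the jet of order \<open>m\<close>.\<close>

lemma sum_fejer_blocks:
  assumes g: "g holomorphic_on UNIV" and G: "1 \<le> G"
  shows "vanishes_to (\<lambda>w. g w - (\<Sum>j<m + 2. fejer_block g G (int m - int (j * G)) w)) 0 m"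
proof -
  define A where "A = (\<lambda>w k. taylor_coeff g k * w ^ nat k)"
  have S: "(\<Sum>j<m + 2. \<Sum>b<G. A w (int m - int (j * G) + int a - int b)) = (\<Sum>k<m + a + 1. A w (int k))"
    if "a < G" for a w
  proof -
    have "(\<Sum>j<m + 2. \<Sum>b<G. A w (int m - int (j * G) + int a - int b)) =
        (\<Sum>j<m + 2. \<Sum>i = j * G..<j * G + G. A w (int m + int a - int i))"
    proof (rule sum.cong[OF refl])
      fix j
      have "(\<Sum>i = j * G..<j * G + G. A w (int m + int a - int i)) =
          (\<Sum>b = 0..<G. A w (int m + int a - int (b + j * G)))"
        using sum.shift_bounds_nat_ivl[of "\<lambda>i. A w (int m + int a - int i)" 0 "j * G" G]
        by (simp add: add.commute)
      then show "(\<Sum>b<G. A w (int m - int (j * G) + int a - int b)) =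
          (\<Sum>i = j * G..<j * G + G. A w (int m + int a - int i))"
        by (simp add: lessThan_atLeast0 algebra_simps)
    qed
    also have "\<dots> = (\<Sum>i<(m + 2) * G. A w (int m + int a - int i))"
      by (rule sum.nat_group)
    also have "\<dots> = (\<Sum>i<m + a + 1. A w (int m + int a - int i))"
    proof (rule sum.mono_neutral_right)
      \<comment> \<open>\<open>m + 2\<close> blocks pass frequency 0 for every \<open>a < G\<close>;
        what lies beyond has negative index and coefficient 0.\<close>
      have "m + a + 1 \<le> (m + 2) * G"
        using that mult_le_mono2[OF G, of m] unfolding distrib_right by linarith
      then show "{..<m + a + 1} \<subseteq> {..<(m + 2) * G}" by auto
      show "\<forall>i\<in>{..<(m + 2) * G} - {..<m + a + 1}. A w (int m + int a - int i) = 0"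
        by (auto simp: A_def taylor_coeff_def)
    qed auto
    also have "\<dots> = (\<Sum>k<m + a + 1. A w (int k))"
      by (rule sum.reindex_bij_witness[of _ "\<lambda>k. m + a - k" "\<lambda>k. m + a - k"]) (auto simp: algebra_simps of_nat_diff)
    finally show ?thesis .
  qed
  have blocks: "(\<Sum>j<m + 2. fejer_block g G (int m - int (j * G)) w) =
      (\<Sum>a<G. (\<Sum>k<m + a + 1. A w (int k)) / of_nat G)" for w
  proof -
    have "(\<Sum>j<m + 2. fejer_block g G (int m - int (j * G)) w) =
        (\<Sum>j<m + 2. \<Sum>a<G. \<Sum>b<G. A w (int m - int (j * G) + int a - int b) / of_nat G)"
      unfolding fejer_block_def A_def sum.cartesian_product by (simp add: case_prod_unfold)
    also have "\<dots> = (\<Sum>a<G. \<Sum>j<m + 2. \<Sum>b<G. A w (int m - int (j * G) + int a - int b) / of_nat G)"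
      by (rule sum.swap)
    also have "\<dots> = (\<Sum>a<G. (\<Sum>k<m + a + 1. A w (int k)) / of_nat G)"
      by (rule sum.cong[OF refl]) (simp only: sum_divide_distrib[symmetric] S lessThan_iff)
    finally show ?thesis .
  qed
  have "\<exists>h. h holomorphic_on UNIV \<and> (\<forall>w. g w = (\<Sum>k<m + a + 1. A w (int k)) + w ^ (m + a + 1) * h w)" for a
  proof -
    obtain h where "h holomorphic_on UNIV"
      "\<And>w. g w = (\<Sum>k<m + a + 1. (deriv ^^ k) g 0 / fact k * (w - 0) ^ k) + (w - 0) ^ (m + a + 1) * h w"
      using taylor_remainder_entire[OF g, where n = "m + a + 1"] by blast
    then show ?thesis by (auto simp: A_def taylor_coeff_def)
  qed
  then obtain h where h: "\<And>a. h a holomorphic_on UNIV"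
    "\<And>a w. g w = (\<Sum>k<m + a + 1. A w (int k)) + w ^ (m + a + 1) * h a w"
    by metis
  show ?thesis
  proof (rule vanishes_toI)
    show "(\<lambda>w. \<Sum>a<G. w ^ (a + 1) * h a w / of_nat G) holomorphic_on UNIV"
      using G by (intro holomorphic_intros h(1)) auto
    fix w
    have "g w = (\<Sum>a<G. g w / of_nat G)" using G by simp
    also have "\<dots> = (\<Sum>a<G. (\<Sum>k<m + a + 1. A w (int k)) / of_nat G + w ^ (m + a + 1) * h a w / of_nat G)"
      by (rule sum.cong[OF refl]) (subst h(2), rule add_divide_distrib)
    finally show "g w - (\<Sum>j<m + 2. fejer_block g G (int m - int (j * G)) w) =
        (w - 0) ^ m * (\<Sum>a<G. w ^ (a + 1) * h a w / of_nat G)"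
      unfolding blocks sum.distrib by (simp add: sum_distrib_left power_add mult_ac)
  qed
qed

section \<open>Local interpolation\<close>

text \<open>One geometric series for each sign. The bound is uniform in \<open>I\<close>, since the
  shift \<open>k\<close> in the later sums depends on the point.\<close>

lemma sum_exp_neg_abs_int:
  fixes I :: "int set"
  assumes "finite I" "0 < c"
  shows "(\<Sum>a\<in>I. exp (- c * \<bar>real_of_int a\<bar>)) \<le> 2 / (1 - exp (- c))"
proof -
  define x where "x = exp (- c)"
  have x: "0 < x" "x < 1" using assms(2) by (auto simp: x_def)
  have e: "exp (- c * \<bar>real_of_int a\<bar>) = x ^ nat \<bar>a\<bar>" for a
    unfolding x_def exp_of_nat_mult[symmetric] by (simp add: mult.commute)
  have half: "(\<Sum>a\<in>J. exp (- c * \<bar>real_of_int a\<bar>)) \<le> 1 / (1 - x)"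
    if "finite J" "inj_on (\<lambda>a. nat \<bar>a\<bar>) J" for J :: "int set"
  proof -
    have "(\<Sum>a\<in>J. exp (- c * \<bar>real_of_int a\<bar>)) = (\<Sum>k\<in>(\<lambda>a. nat \<bar>a\<bar>) ` J. x ^ k)"
      unfolding e sum.reindex[OF that(2)] o_def ..
    also have "\<dots> \<le> (\<Sum>k. x ^ k)"
      using x that(1) by (intro sum_le_suminf summable_geometric) auto
    also have "\<dots> = 1 / (1 - x)" using x by (intro suminf_geometric) auto
    finally show ?thesis .
  qed
  have "(\<Sum>a\<in>I. exp (- c * \<bar>real_of_int a\<bar>)) =
      (\<Sum>a\<in>I \<inter> {0..}. exp (- c * \<bar>real_of_int a\<bar>)) + (\<Sum>a\<in>I \<inter> {..<0}. exp (- c * \<bar>real_of_int a\<bar>))"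
    by (subst sum.union_disjoint[symmetric]) (use assms(1) in \<open>auto intro!: sum.cong\<close>)
  also have "\<dots> \<le> 1 / (1 - x) + 1 / (1 - x)"
    using assms(1) by (intro add_mono half) (auto simp: inj_on_def)
  finally show ?thesis by (simp add: x_def)
qed

text \<open>Expanding \<open>0 \<le> (v / 4 - 1)\<^sup>2\<close> trades Gaussian decay for
  exponential decay, which sums as a geometric series.\<close>

lemma square_half_ge:
  fixes u v :: real
  assumes "v / 4 \<le> u" "0 \<le> v"
  shows "v / 4 - 1 / 2 \<le> u\<^sup>2 / 2"
proof -
  have "(v / 4)\<^sup>2 \<le> u\<^sup>2" using assms by (intro power_mono) auto
  moreover have "0 \<le> (v / 4 - 1)\<^sup>2" by simp
  ultimately show ?thesis by (simp add: power2_diff)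
qed

text \<open>Difference of squares. With \<open>G\<close> about \<open>sqrt m\<close>, frequencies
  \<open>v * G\<close> apart belong to circles whose radii differ by at least
  \<open>v / 4\<close>.\<close>

lemma sqrt_diff_ge:
  fixes a b S G v :: real
  assumes "0 \<le> a" "0 \<le> b" "0 < G" "0 \<le> v" "a - b = v * G" "sqrt a + sqrt b \<le> 4 * G"
  shows "v / 4 \<le> sqrt a - sqrt b"
proof -
  have "0 \<le> v * G" using assms(3,4) by simp
  then have "b \<le> a" using assms(5) by linarith
  have "v * G = (sqrt a - sqrt b) * (sqrt a + sqrt b)"
    using assms by (simp add: algebra_simps)
  also have "\<dots> \<le> (sqrt a - sqrt b) * (4 * G)"
    using assms \<open>b \<le> a\<close> by (intro mult_left_mono) auto
  finally have "v * G \<le> (4 * (sqrt a - sqrt b)) * G" by (simp add: algebra_simps)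
  then show ?thesis using assms(3) by simp
qed

text \<open>Block \<open>j\<close> lives near radius \<open>sqrt (m - j * G)\<close>, and by the
  choice of \<open>G\<close> these radii are at least \<open>1 / 4\<close> apart. Gaussian decay in
  the radius thus becomes exponential decay in the distance of \<open>j\<close> from the index
  \<open>k\<close> matching \<open>norm w\<close>. Outside all circles \<open>k = 0\<close>, and the
  distance to the disc contributes a further Gaussian factor.\<close>

lemma fejer_block_gauss_decay:
  fixes m G :: nat
  assumes g: "g holomorphic_on UNIV" and m: "1 \<le> m" and G: "sqrt m \<le> G" "G \<le> sqrt m + 1"
    and bound: "\<And>u. norm u \<le> sqrt m + 1 \<Longrightarrow> norm (g u) \<le> \<epsilon> * exp ((norm u)\<^sup>2 / 2)"
  obtains k :: int where "\<And>j. norm (fejer_block g G (int m - int (j * G)) w) \<le>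
    \<epsilon> * exp ((norm w)\<^sup>2 / 2 - (max 0 (norm w - sqrt m - 1))\<^sup>2 / 2 + (1 - \<bar>real_of_int (int j - k)\<bar> / 4))"
proof -
  define t where "t = norm w"
  define S where "S = sqrt (real m + G)"
  define D where "D = max 0 (t - sqrt m - 1)"
  have sm: "1 \<le> sqrt (real m)" using m by simp
  have G1: "1 \<le> G" using sm G(1) by linarith
  \<comment> \<open>All circles used below have radius at most \<open>S\<close>, so they stay where
    \<open>bound\<close> applies.\<close>
  have S: "S \<le> sqrt m + 1"
  proof -
    have "(sqrt m + 1)\<^sup>2 = m + 2 * sqrt m + 1" by (simp add: power2_sum)
    then have "real m + G \<le> (sqrt m + 1)\<^sup>2" using sm G(2) by linarith
    then show ?thesis unfolding S_def using sm by (intro real_le_lsqrt) auto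
  qed
  \<comment> \<open>Any two radii up to \<open>S\<close> therefore satisfy the last premise of
    \<open>sqrt_diff_ge\<close>.\<close>
  have S4: "2 * S \<le> 4 * G" using S sm G(1) by linarith
  have eps: "0 \<le> \<epsilon>" using order_trans[OF norm_ge_zero bound[of 0]] by simp
  have t0: "0 \<le> t" by (simp add: t_def)
  note bb = fejer_block_bounds[OF g G1 bound]
  have zero: "norm (fejer_block g G (int m - int (j * G)) w) \<le> \<epsilon> * exp y"
    if "int m + int G - int (j * G) \<le> 0" for j y
    using fejer_block_eq_0[of "int m - int (j * G)" G] that eps by (simp add: algebra_simps)
  \<comment> \<open>Here the degree circle of the block lies inside the circle through
    \<open>w\<close>; \<open>down\<close> treats the circle given by the order of vanishing when it
    lies outside.\<close>
  have up: "norm (fejer_block g G (int m - int (j * G)) w) \<le> \<epsilon> * exp (t\<^sup>2 / 2 - x)"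
    if "1 \<le> N" "N = int m + int G - int (j * G)" "sqrt N \<le> t" "x \<le> (t - sqrt N)\<^sup>2 / 2" for j N x
  proof -
    have "sqrt N \<le> S" unfolding S_def that(2) by (intro real_sqrt_le_mono) simp
    then have "norm (fejer_block g G (int m - int (j * G)) w) \<le> \<epsilon> * exp (t\<^sup>2 / 2 - (t - sqrt N)\<^sup>2 / 2)"
      unfolding t_def using that S by (intro bb(2)) (auto simp: t_def)
    also have "\<dots> \<le> \<epsilon> * exp (t\<^sup>2 / 2 - x)" using eps that(4) by (intro mult_left_mono) auto
    finally show ?thesis .
  qed
  have down: "norm (fejer_block g G (int m - int (j * G)) w) \<le> \<epsilon> * exp (t\<^sup>2 / 2 - x)"
    if "1 \<le> N" "N = int m - int G - int (j * G)" "t \<le> sqrt N" "x \<le> (sqrt N - t)\<^sup>2 / 2" for j N x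
  proof -
    have "sqrt N \<le> S" unfolding S_def that(2)
      by (intro real_sqrt_le_mono) (simp add: add_increasing2 diff_le_eq)
    then have "norm (fejer_block g G (int m - int (j * G)) w) \<le> \<epsilon> * exp (t\<^sup>2 / 2 - (t - sqrt N)\<^sup>2 / 2)"
      unfolding t_def using that S by (intro bb(3)) (auto simp: t_def)
    also have "\<dots> \<le> \<epsilon> * exp (t\<^sup>2 / 2 - x)"
      using eps that(4) by (intro mult_left_mono) (auto simp: power2_commute)
    finally show ?thesis .
  qed
  \<comment> \<open>The \<open>2\<close> absorbs the rounding of \<open>y\<close> to
    \<open>k\<close> and the two index steps between the outer and inner circle of a block. With the
    \<open>1 / 2\<close> from \<open>square_half_ge\<close> this makes up the constant 1 in the
    exponent.\<close>
  have arith: "- (1 - a / 4) \<le> x" if "v / 4 - 1 / 2 \<le> x" "a \<le> v + 2" for a v x :: real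
    using that by linarith
  show ?thesis
  proof (cases "S \<le> t")
    \<comment> \<open>\<open>w\<close> lies outside every circle. The gap from \<open>sqrt N\<close>
      to \<open>t\<close> is split at \<open>S\<close>: one piece yields \<open>D\<close>, the other
      the decay in \<open>j\<close>, and squares of nonnegative gaps are superadditive.\<close>
    case True
    have "norm (fejer_block g G (int m - int (j * G)) w) \<le>
        \<epsilon> * exp (t\<^sup>2 / 2 - D\<^sup>2 / 2 + (1 - \<bar>real_of_int (int j - 0)\<bar> / 4))" for j
    proof (cases "int m + int G - int (j * G) \<le> 0")
      case False
      define N where "N = int m + int G - int (j * G)"
      have N: "1 \<le> N" using False by (simp add: N_def)
      have NS: "sqrt N \<le> S" unfolding S_def N_def by (intro real_sqrt_le_mono) simp
      have d: "real m + G - N = real j * G" by (simp add: N_def)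
      have "real j / 4 \<le> S - sqrt N"
        unfolding S_def
      proof (rule sqrt_diff_ge[OF _ _ _ _ d])
        show "sqrt (real m + G) + sqrt N \<le> 4 * real G" using S4 NS unfolding S_def by linarith
      qed (use N G1 in auto)
      then have "real j / 4 - 1 / 2 \<le> (S - sqrt N)\<^sup>2 / 2" by (rule square_half_ge) simp
      moreover have "D\<^sup>2 \<le> (t - S)\<^sup>2"
        unfolding D_def using True S by (intro power_mono) auto
      moreover have "(t - S)\<^sup>2 + (S - sqrt N)\<^sup>2 \<le> (t - sqrt N)\<^sup>2"
      proof -
        have "0 \<le> (t - S) * (S - sqrt N)" using True NS by simp
        then show ?thesis by (simp add: power2_eq_square algebra_simps)
      qed
      ultimately have "D\<^sup>2 / 2 - (1 - \<bar>real_of_int (int j - 0)\<bar> / 4) \<le> (t - sqrt N)\<^sup>2 / 2" by simp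
      from up[OF N N_def _ this] True NS show ?thesis by (simp add: algebra_simps)
    qed (rule zero)
    then show ?thesis using that unfolding t_def D_def by blast
  next
    case False
    then have D: "D = 0" using S by (auto simp: D_def)
    \<comment> \<open>The real index at which the outer radius \<open>sqrt (m + G - y * G)\<close>
      equals \<open>t\<close>.\<close>
    define y where "y = (real m + G - t\<^sup>2) / G"
    define k where "k = \<lfloor>y\<rfloor>"
    have k: "real_of_int k \<le> y" "y < real_of_int k + 1" unfolding k_def by linarith+
    have yG: "y * G = real m + G - t\<^sup>2" using G1 by (simp add: y_def)
    have "norm (fejer_block g G (int m - int (j * G)) w) \<le>
        \<epsilon> * exp (t\<^sup>2 / 2 + (1 - \<bar>real_of_int (int j - k)\<bar> / 4))" for j
    proof -
      \<comment> \<open>In the third case \<open>w\<close> lies between the two circles of the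
        block; the plain circle bound suffices there because \<open>j\<close> differs from
        \<open>k\<close> by at most 2.\<close>
      consider "int m + int G - int (j * G) \<le> 0" | "0 < int m + int G - int (j * G)" "y \<le> j"
        | "y - 2 \<le> j" "j < y" | "j < y - 2" by linarith
      then show ?thesis
      proof cases
        case 1
        then show ?thesis by (rule zero)
      next
        case 2
        define N where "N = int m + int G - int (j * G)"
        have N: "1 \<le> N" using 2 by (simp add: N_def)
        have d: "t\<^sup>2 - N = (j - y) * G" by (simp add: N_def left_diff_distrib yG)
        have "0 \<le> (j - y) * G" using 2 by simp
        then have Nt: "sqrt N \<le> t" using d t0 by (intro real_le_lsqrt) auto
        have "(j - y) / 4 \<le> sqrt (t\<^sup>2) - sqrt N"
          by (rule sqrt_diff_ge[OF _ _ _ _ d]) (use N G1 S4 Nt 2 False t0 in auto)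
        then have "(j - y) / 4 - 1 / 2 \<le> (t - sqrt N)\<^sup>2 / 2"
          using 2 t0 by (intro square_half_ge) auto
        then have "- (1 - \<bar>real_of_int (int j - k)\<bar> / 4) \<le> (t - sqrt N)\<^sup>2 / 2"
          by (rule arith) (use 2 k in simp)
        from up[OF N N_def Nt this] show ?thesis by (simp add: algebra_simps)
      next
        case 3
        have "norm (fejer_block g G (int m - int (j * G)) w) \<le> \<epsilon> * exp (t\<^sup>2 / 2)"
          unfolding t_def using False S by (intro bb(1)) (auto simp: t_def)
        also have "\<dots> \<le> \<epsilon> * exp (t\<^sup>2 / 2 + (1 - \<bar>real_of_int (int j - k)\<bar> / 4))"
          using eps 3 k by (intro mult_left_mono) auto
        finally show ?thesis .
      next
        case 4
        define N where "N = int m - int G - int (j * G)"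
        have d: "N - t\<^sup>2 = (y - 2 - j) * G" by (simp add: N_def left_diff_distrib yG)
        have "0 < (y - 2 - j) * G" using 4 G1 by simp
        then have "t\<^sup>2 < N" using d by simp
        then have "0 < real_of_int N" by (rule le_less_trans[OF zero_le_power2])
        then have N: "1 \<le> N" by simp
        have tN: "t \<le> sqrt N" using \<open>t\<^sup>2 < N\<close> by (intro real_le_rsqrt) simp
        have NS: "sqrt N \<le> S" unfolding S_def N_def
          by (intro real_sqrt_le_mono) (simp add: add_increasing2 diff_le_eq)
        have "(y - 2 - j) / 4 \<le> sqrt N - sqrt (t\<^sup>2)"
          by (rule sqrt_diff_ge[OF _ _ _ _ d]) (use N G1 S4 NS 4 False t0 in auto)
        then have "(y - 2 - j) / 4 - 1 / 2 \<le> (sqrt N - t)\<^sup>2 / 2"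
          using 4 t0 by (intro square_half_ge) auto
        then have "- (1 - \<bar>real_of_int (int j - k)\<bar> / 4) \<le> (sqrt N - t)\<^sup>2 / 2"
          by (rule arith) (use 4 k in simp)
        from down[OF N N_def tN this] show ?thesis by (simp add: algebra_simps)
      qed
    qed
    then show ?thesis using that[of k] D unfolding t_def D_def by simp
  qed
qed

text \<open>\<open>exp 1\<close> is the loss in each block; the other factor bounds the two-sided
  geometric sum of ratio \<open>exp (- (1 / 4))\<close>.\<close>

definition local_const :: real where
  "local_const = exp 1 * (2 / (1 - exp (- (1 / 4))))"

lemma local_const_pos: "0 < local_const"
  by (simp add: local_const_def)

text \<open>Exponential decay in the block index makes the sum over \<open>m + 2\<close> blocks
  bounded independently of \<open>m\<close>. The input is controlled only near the disc, but the
  output everywhere.\<close>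

lemma local_interpolation:
  assumes g: "g holomorphic_on UNIV" and m: "1 \<le> m"
    and bound: "\<And>u. norm u \<le> sqrt m + 1 \<Longrightarrow> norm (g u) \<le> \<epsilon> * exp ((norm u)\<^sup>2 / 2)"
  obtains p where "p holomorphic_on UNIV" "vanishes_to (\<lambda>w. g w - p w) 0 m"
    "\<And>w. norm (p w) \<le> local_const * \<epsilon> * exp ((norm w)\<^sup>2 / 2 - (max 0 (norm w - sqrt m - 1))\<^sup>2 / 2)"
proof -
  define G where "G = nat \<lceil>sqrt m\<rceil>"
  have G: "sqrt m \<le> G" "G \<le> sqrt m + 1" "1 \<le> G"
    using m real_sqrt_ge_one[of m] unfolding G_def by linarith+
  define p where "p = (\<lambda>w. \<Sum>j<m + 2. fejer_block g G (int m - int (j * G)) w)"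
  have eps: "0 \<le> \<epsilon>" using order_trans[OF norm_ge_zero bound[of 0]] by simp
  show ?thesis
  proof (rule that)
    show "p holomorphic_on UNIV"
      unfolding p_def fejer_block_def case_prod_unfold using G(3) by (intro holomorphic_intros) auto
    show "vanishes_to (\<lambda>w. g w - p w) 0 m"
      unfolding p_def by (rule sum_fejer_blocks[OF g G(3)])
    fix w :: complex
    define E where "E = (norm w)\<^sup>2 / 2 - (max 0 (norm w - sqrt m - 1))\<^sup>2 / 2"
    obtain k :: int where k: "\<And>j. norm (fejer_block g G (int m - int (j * G)) w) \<le>
        \<epsilon> * exp (E + (1 - \<bar>real_of_int (int j - k)\<bar> / 4))"
      using fejer_block_gauss_decay[OF g m G(1,2) bound, of w] unfolding E_def by metis
    have "norm (p w) \<le> (\<Sum>j<m + 2. \<epsilon> * exp (E + (1 - \<bar>real_of_int (int j - k)\<bar> / 4)))"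
      unfolding p_def by (intro sum_norm_le k)
    also have "\<dots> = \<epsilon> * exp E * exp 1 * (\<Sum>j<m + 2. exp (- (1 / 4) * \<bar>real_of_int (int j - k)\<bar>))"
      unfolding sum_distrib_left
      by (intro sum.cong refl) (simp add: mult.assoc exp_add[symmetric])
    also have "(\<Sum>j<m + 2. exp (- (1 / 4) * \<bar>real_of_int (int j - k)\<bar>)) =
        (\<Sum>a\<in>(\<lambda>j. int j - k) ` {..<m + 2}. exp (- (1 / 4) * \<bar>real_of_int a\<bar>))"
      by (subst sum.reindex) (auto simp: inj_on_def)
    also have "\<epsilon> * exp E * exp 1 * \<dots> \<le> \<epsilon> * exp E * exp 1 * (2 / (1 - exp (- (1 / 4))))"
      using eps by (intro mult_left_mono sum_exp_neg_abs_int) auto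
    also have "\<dots> = local_const * \<epsilon> * exp E" by (simp add: local_const_def)
    finally show "norm (p w) \<le> local_const * \<epsilon> * exp E" .
  qed
qed

section \<open>Decay at a general centre and lattice sums\<close>

text \<open>The normalised reproducing kernel at \<open>l\<close> of the Hilbert Fock space with
  weight \<open>\<alpha>\<close>. Its weighted modulus is a Gaussian of height 1 at
  \<open>l\<close>, and it has no zeros, so one may divide by it to translate.\<close>

definition fock_kernel :: "real \<Rightarrow> complex \<Rightarrow> complex \<Rightarrow> complex" where
  "fock_kernel \<alpha> l z = exp (of_real \<alpha> * cnj l * z - of_real (\<alpha> / 2 * (norm l)\<^sup>2))"

lemma fock_kernel_holo [holomorphic_intros]: "fock_kernel \<alpha> l holomorphic_on A"
  unfolding fock_kernel_def[abs_def] by (intro holomorphic_intros)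

lemma fock_kernel_nonzero [simp]: "fock_kernel \<alpha> l z \<noteq> 0"
  by (simp add: fock_kernel_def)

lemma norm_fock_kernel:
  "norm (fock_kernel \<alpha> l z) = exp (\<alpha> / 2 * (norm z)\<^sup>2 - (\<alpha> / 2) * (norm (z - l))\<^sup>2)"
proof -
  have "Re (of_real \<alpha> * cnj l * z - of_real (\<alpha> / 2 * (norm l)\<^sup>2)) =
      \<alpha> / 2 * (norm z)\<^sup>2 - (\<alpha> / 2) * (norm (z - l))\<^sup>2"
    by (simp only: cmod_power2) (simp add: power2_eq_square field_simps)
  then show ?thesis unfolding fock_kernel_def by (simp only: norm_exp_eq_Re)
qed

lemma fock_le_fock_kernel:
  assumes "0 < \<alpha>"
  shows "fock_le \<alpha> 1 (fock_kernel \<alpha> l)"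
  by (rule fock_leI) (use assms in \<open>auto simp: norm_fock_kernel intro!: holomorphic_intros\<close>)

text \<open>A Weyl translation followed by a dilation: it moves \<open>l\<close> to 0 and
  \<open>\<alpha>\<close> to 1 and preserves weighted moduli at corresponding points.\<close>

definition recentre :: "real \<Rightarrow> complex \<Rightarrow> (complex \<Rightarrow> complex) \<Rightarrow> complex \<Rightarrow> complex" where
  "recentre \<alpha> l g w = g (l + w / of_real (sqrt \<alpha>)) / fock_kernel \<alpha> l (l + w / of_real (sqrt \<alpha>))"

lemma recentre_holo:
  assumes "g holomorphic_on UNIV" "0 < \<alpha>"
  shows "recentre \<alpha> l g holomorphic_on UNIV"
proof -
  have "(\<lambda>z. g z / fock_kernel \<alpha> l z) holomorphic_on UNIV"
    using assms by (auto intro!: holomorphic_intros)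
  moreover have "(\<lambda>w. l + w / of_real (sqrt \<alpha>)) holomorphic_on UNIV"
    using assms(2) by (auto intro!: holomorphic_intros)
  ultimately have "((\<lambda>z. g z / fock_kernel \<alpha> l z) \<circ> (\<lambda>w. l + w / of_real (sqrt \<alpha>))) holomorphic_on UNIV"
    by (intro holomorphic_on_compose_gen[where t = UNIV]) auto
  then show ?thesis by (simp add: recentre_def[abs_def] o_def)
qed

lemma recentre_eq:
  assumes "0 < \<alpha>"
  shows "g z = fock_kernel \<alpha> l z * recentre \<alpha> l g (of_real (sqrt \<alpha>) * (z - l))"
  using assms by (simp add: recentre_def)

lemma norm_recentre_le:
  assumes "0 < \<alpha>" and z: "z = l + w / of_real (sqrt \<alpha>)"
    and "norm (g z) \<le> B * exp (\<alpha> / 2 * (norm z)\<^sup>2)"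
  shows "norm (recentre \<alpha> l g w) \<le> B * exp ((norm w)\<^sup>2 / 2)"
proof -
  have "\<alpha> / 2 * (norm (z - l))\<^sup>2 = (norm w)\<^sup>2 / 2"
    using assms(1) by (simp add: z norm_divide power_divide)
  then have "exp (\<alpha> / 2 * (norm z)\<^sup>2) = exp ((norm w)\<^sup>2 / 2) * norm (fock_kernel \<alpha> l z)"
    unfolding norm_fock_kernel exp_add[symmetric] by simp
  then show ?thesis
    using assms(3) unfolding recentre_def z[symmetric] norm_divide
    by (simp add: field_simps)
qed

lemma recentre_vanishes:
  assumes "vanishes_to g l n" "0 < \<alpha>"
  shows "vanishes_to (recentre \<alpha> l g) 0 n"
proof -
  obtain h where h: "h holomorphic_on UNIV" "\<And>z. g z = (z - l) ^ n * h z"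
    using assms(1) unfolding vanishes_to_def by blast
  show ?thesis
  proof (rule vanishes_toI)
    show "(\<lambda>w. recentre \<alpha> l h w / of_real (sqrt \<alpha>) ^ n) holomorphic_on UNIV"
      using recentre_holo[OF h(1) assms(2)] assms(2) by (auto intro!: holomorphic_intros)
    show "recentre \<alpha> l g z = (z - 0) ^ n * (recentre \<alpha> l h z / of_real (sqrt \<alpha>) ^ n)" for z
      by (simp add: recentre_def h(2) power_divide)
  qed
qed

text \<open>After recentring, the point lies at least \<open>sqrt \<alpha> * c\<close> inside the
  circle of radius \<open>sqrt n\<close>, and \<open>gauss_bound_inside\<close> applies.\<close>

lemma fock_decay_near_zero:
  assumes \<alpha>: "0 < \<alpha>" and f: "fock_le \<alpha> K f" "vanishes_to f l n" "1 \<le> n"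
    and z: "dist z l \<le> sqrt (n / \<alpha>) - c" and c: "0 \<le> c"
  shows "norm (f z) \<le> K * exp (\<alpha> / 2 * (norm z)\<^sup>2) * exp (- (\<alpha> * c\<^sup>2 / 2))"
proof -
  define w where "w = of_real (sqrt \<alpha>) * (z - l)"
  have nw: "norm w = sqrt \<alpha> * dist z l" using \<alpha> by (simp add: w_def norm_mult dist_norm)
  have "sqrt \<alpha> * dist z l \<le> sqrt \<alpha> * (sqrt (n / \<alpha>) - c)" using z \<alpha> by (intro mult_left_mono) auto
  also have "\<dots> = sqrt n - sqrt \<alpha> * c" using \<alpha> by (simp add: real_sqrt_divide right_diff_distrib)
  finally have w: "norm w \<le> sqrt n - sqrt \<alpha> * c" unfolding nw .
  have sc: "0 \<le> sqrt \<alpha> * c" using \<alpha> c by simp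
  have "norm (recentre \<alpha> l f w) \<le> K * exp ((norm w)\<^sup>2 / 2 - (norm w - sqrt n)\<^sup>2 / 2)"
  proof (rule gauss_bound_inside)
    show "norm (recentre \<alpha> l f u) \<le> K * exp ((norm u)\<^sup>2 / 2)" for u
      using norm_recentre_le[OF \<alpha> refl] fock_le_bound[OF f(1)] by blast
  qed (use f(3) w sc recentre_vanishes[OF f(2) \<alpha>] in auto)
  also have "\<dots> \<le> K * exp (\<alpha> / 2 * (norm (z - l))\<^sup>2 - \<alpha> * c\<^sup>2 / 2)"
  proof -
    have "(sqrt \<alpha> * c)\<^sup>2 \<le> (sqrt n - norm w)\<^sup>2" using w sc by (intro power_mono) auto
    then have "\<alpha> * c\<^sup>2 \<le> (norm w - sqrt n)\<^sup>2" using \<alpha> by (simp add: power_mult_distrib power2_commute)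
    moreover have "(norm w)\<^sup>2 = \<alpha> * (norm (z - l))\<^sup>2" using \<alpha> by (simp add: nw power_mult_distrib dist_norm)
    ultimately show ?thesis using fock_le_nonneg[OF f(1)] by (intro mult_left_mono) auto
  qed
  finally have "norm (fock_kernel \<alpha> l z) * norm (recentre \<alpha> l f w) \<le>
      norm (fock_kernel \<alpha> l z) * (K * exp (\<alpha> / 2 * (norm (z - l))\<^sup>2 - \<alpha> * c\<^sup>2 / 2))"
    by (rule mult_left_mono) simp
  also have "\<dots> = K * (norm (fock_kernel \<alpha> l z) * exp (\<alpha> / 2 * (norm (z - l))\<^sup>2 - \<alpha> * c\<^sup>2 / 2))"
    by simp
  also have "norm (fock_kernel \<alpha> l z) * exp (\<alpha> / 2 * (norm (z - l))\<^sup>2 - \<alpha> * c\<^sup>2 / 2) =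
      exp (\<alpha> / 2 * (norm z)\<^sup>2) * exp (- (\<alpha> * c\<^sup>2 / 2))"
    unfolding norm_fock_kernel exp_add[symmetric] by simp
  finally show ?thesis
    using recentre_eq[OF \<alpha>, of f z l] by (simp add: norm_mult w_def mult.assoc)
qed

text \<open>The decay factor of \<open>local_interpolation\<close> in the original coordinates: the
  rescaled distance to the disc counts only beyond a margin of 1.\<close>

definition disc_weight :: "real \<Rightarrow> complex \<Rightarrow> nat \<Rightarrow> complex \<Rightarrow> real" where
  "disc_weight \<alpha> l n z = exp (- (max 0 (sqrt \<alpha> * (dist z l - sqrt (n / \<alpha>)) - 1))\<^sup>2 / 2)"

lemma disc_weight_le_1: "disc_weight \<alpha> l n z \<le> 1"
  by (simp add: disc_weight_def)

text \<open>\<open>local_interpolation\<close> transported back from the recentred picture. Passing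
  from a bound near one disc to a bound on the whole plane is what later allows errors to be
  corrected disc by disc.\<close>

lemma fock_local_interpolation:
  assumes \<alpha>: "0 < \<alpha>" and g: "g holomorphic_on UNIV" and n: "1 \<le> n"
    and bound: "\<And>z. dist z l \<le> sqrt (n / \<alpha>) + 1 / sqrt \<alpha> \<Longrightarrow>
      norm (g z) \<le> \<epsilon> * exp (\<alpha> / 2 * (norm z)\<^sup>2)"
  obtains p where "p holomorphic_on UNIV" "vanishes_to (\<lambda>z. g z - p z) l n"
    "\<And>z. norm (p z) \<le> local_const * \<epsilon> * disc_weight \<alpha> l n z * exp (\<alpha> / 2 * (norm z)\<^sup>2)"
proof -
  define s where "s = complex_of_real (sqrt \<alpha>)"
  have b: "norm (recentre \<alpha> l g u) \<le> \<epsilon> * exp ((norm u)\<^sup>2 / 2)" if "norm u \<le> sqrt n + 1" for u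
  proof (rule norm_recentre_le[OF \<alpha> refl, of g], rule bound)
    have "norm u / sqrt \<alpha> \<le> (sqrt n + 1) / sqrt \<alpha>" using that \<alpha> by (intro divide_right_mono) auto
    then show "dist (l + u / complex_of_real (sqrt \<alpha>)) l \<le> sqrt (n / \<alpha>) + 1 / sqrt \<alpha>"
      using \<alpha> by (simp add: dist_norm norm_divide real_sqrt_divide add_divide_distrib)
  qed
  obtain P where P: "P holomorphic_on UNIV" "vanishes_to (\<lambda>w. recentre \<alpha> l g w - P w) 0 n"
    "\<And>w. norm (P w) \<le> local_const * \<epsilon> * exp ((norm w)\<^sup>2 / 2 - (max 0 (norm w - sqrt n - 1))\<^sup>2 / 2)"
    using local_interpolation[OF recentre_holo[OF g \<alpha>] n b, where thesis = thesis] by blast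
  obtain h where h: "h holomorphic_on UNIV" "\<And>w. recentre \<alpha> l g w - P w = w ^ n * h w"
    using P(2) unfolding vanishes_to_def by auto
  have scale: "(\<lambda>z. F (s * (z - l))) holomorphic_on UNIV" if "F holomorphic_on UNIV" for F
    by (rule holomorphic_on_compose_gen[OF _ that, unfolded o_def]) (auto intro!: holomorphic_intros)
  show ?thesis
  proof (rule that)
    show "(\<lambda>z. fock_kernel \<alpha> l z * P (s * (z - l))) holomorphic_on UNIV"
      by (intro holomorphic_intros scale P)
    show "vanishes_to (\<lambda>z. g z - fock_kernel \<alpha> l z * P (s * (z - l))) l n"
    proof (rule vanishes_toI)
      show "(\<lambda>z. fock_kernel \<alpha> l z * (s ^ n * h (s * (z - l)))) holomorphic_on UNIV"
        by (intro holomorphic_intros scale h)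
      show "g z - fock_kernel \<alpha> l z * P (s * (z - l)) =
          (z - l) ^ n * (fock_kernel \<alpha> l z * (s ^ n * h (s * (z - l))))" for z
      proof -
        have "g z - fock_kernel \<alpha> l z * P (s * (z - l)) =
            fock_kernel \<alpha> l z * (recentre \<alpha> l g (s * (z - l)) - P (s * (z - l)))"
          using recentre_eq[OF \<alpha>, of g z l] by (simp add: s_def algebra_simps)
        then show ?thesis unfolding h(2) by (simp add: power_mult_distrib)
      qed
    qed
    fix z
    define w where "w = s * (z - l)"
    have nw: "norm w = sqrt \<alpha> * dist z l" using \<alpha> by (simp add: w_def s_def norm_mult dist_norm)
    have e: "sqrt \<alpha> * (dist z l - sqrt (n / \<alpha>)) - 1 = norm w - sqrt n - 1"
      using \<alpha> by (simp add: nw real_sqrt_divide right_diff_distrib)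
    have "norm (fock_kernel \<alpha> l z * P w) \<le> norm (fock_kernel \<alpha> l z) *
        (local_const * \<epsilon> * exp ((norm w)\<^sup>2 / 2 - (max 0 (norm w - sqrt n - 1))\<^sup>2 / 2))"
      unfolding norm_mult by (intro mult_left_mono P) auto
    also have "\<dots> = local_const * \<epsilon> * (norm (fock_kernel \<alpha> l z) *
        exp ((norm w)\<^sup>2 / 2 - (max 0 (norm w - sqrt n - 1))\<^sup>2 / 2))"
      by simp
    also have "norm (fock_kernel \<alpha> l z) * exp ((norm w)\<^sup>2 / 2 - (max 0 (norm w - sqrt n - 1))\<^sup>2 / 2) =
        disc_weight \<alpha> l n z * exp (\<alpha> / 2 * (norm z)\<^sup>2)"
    proof -
      have "(norm w)\<^sup>2 = \<alpha> * (norm (z - l))\<^sup>2" using \<alpha> by (simp add: nw power_mult_distrib dist_norm)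
      then show ?thesis
        unfolding norm_fock_kernel disc_weight_def e exp_add[symmetric] by simp
    qed
    also have "local_const * \<epsilon> * \<dots> = local_const * \<epsilon> * disc_weight \<alpha> l n z * exp (\<alpha> / 2 * (norm z)\<^sup>2)"
      by simp
    finally show "norm (fock_kernel \<alpha> l z * P (s * (z - l))) \<le>
        local_const * \<epsilon> * disc_weight \<alpha> l n z * exp (\<alpha> / 2 * (norm z)\<^sup>2)" unfolding w_def .
  qed
qed

section \<open>Gaussian sums over separated points and discs\<close>

definition lattice_const :: real where
  "lattice_const = (2 / (1 - exp (- (1 / 16))))\<^sup>2"

text \<open>A cell of the grid of side \<open>C\<close> around \<open>z\<close> holds at most one
  point of \<open>Q\<close>, so the sum is dominated by one over the integer lattice. Part of the
  exponent is spent on the small factor in front, the rest on summability over the lattice.\<close>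

lemma separated_gauss_sum:
  fixes Q :: "complex set"
  assumes "finite Q" "0 < C" "2 \<le> s * C" "0 < s"
    and sep: "\<And>q q'. \<lbrakk>q \<in> Q; q' \<in> Q; q \<noteq> q'\<rbrakk> \<Longrightarrow> 2 * C \<le> dist q q'"
    and far: "\<And>q. q \<in> Q \<Longrightarrow> C \<le> dist q z"
  shows "(\<Sum>q\<in>Q. exp (- (s * dist q z - 1)\<^sup>2 / 2)) \<le> exp (- (s * C)\<^sup>2 / 16) * lattice_const"
proof -
  define \<phi> where "\<phi> = (\<lambda>q. (\<lfloor>Re (q - z) / C\<rfloor>, \<lfloor>Im (q - z) / C\<rfloor>))"
  define x where "x = (\<lambda>a::int. exp (- (1 / 16) * \<bar>real_of_int a\<bar>))"
  have inj: "inj_on \<phi> Q"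
  proof (rule inj_onI, rule ccontr)
    fix q q' assume q: "q \<in> Q" "q' \<in> Q" "\<phi> q = \<phi> q'" "q \<noteq> q'"
    have *: "\<bar>u - v\<bar> < C" if "\<lfloor>u / C\<rfloor> = \<lfloor>v / C\<rfloor>" for u v
    proof -
      have "\<bar>u / C - v / C\<bar> < 1" using that by linarith
      then have "\<bar>u - v\<bar> / C < 1" using \<open>0 < C\<close> by (simp add: diff_divide_distrib[symmetric])
      then show ?thesis using \<open>0 < C\<close> by simp
    qed
    have "\<bar>Re (q - q')\<bar> < C" "\<bar>Im (q - q')\<bar> < C"
      using q(3) *[of "Re (q - z)" "Re (q' - z)"] *[of "Im (q - z)" "Im (q' - z)"]
      by (auto simp: \<phi>_def)
    with cmod_le[of "q - q'"] sep[OF q(1,2,4)] show False by (simp add: dist_norm)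
  qed
  have weight_le: "exp (- (s * dist q z - 1)\<^sup>2 / 2) \<le>
      exp (- (s * C)\<^sup>2 / 16) * (case \<phi> q of (a, b) \<Rightarrow> x a * x b)" if "q \<in> Q" for q
  proof -
    define a b where "a = \<lfloor>Re (q - z) / C\<rfloor>" and "b = \<lfloor>Im (q - z) / C\<rfloor>"
    define d c where "d = s * dist q z" and "c = s * C"
    have cd: "c \<le> d" "2 \<le> c" using far[OF that] assms(3,4) by (auto simp: c_def d_def)
    have *: "\<bar>real_of_int \<lfloor>u / C\<rfloor>\<bar> \<le> dist q z / C + 1" if "\<bar>u\<bar> \<le> dist q z" for u
    proof -
      have "\<bar>u / C\<bar> \<le> dist q z / C" using that \<open>0 < C\<close> by (simp add: divide_right_mono)
      then show ?thesis by linarith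
    qed
    \<comment> \<open>Since the distance is at least \<open>C\<close>, the grid index is controlled
      by \<open>4 * d / c\<close>, and \<open>2 \<le> c\<close> turns this into
      \<open>T \<le> 2 * d\<close>.\<close>
    define T where "T = \<bar>real_of_int a\<bar> + \<bar>real_of_int b\<bar>"
    have "T \<le> 2 * (dist q z / C) + 2"
      using *[of "Re (q - z)"] *[of "Im (q - z)"] abs_Re_le_cmod[of "q - z"] abs_Im_le_cmod[of "q - z"]
      by (simp add: T_def a_def b_def dist_norm)
    also have "dist q z / C = d / c" using assms by (simp add: d_def c_def)
    finally have "c * T \<le> c * (2 * (d / c) + 2)"
      using cd by (intro mult_left_mono) auto
    also have "\<dots> \<le> 4 * d" using cd by (simp add: algebra_simps)
    finally have 1: "c * T \<le> 4 * d" .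
    have "2 * T \<le> c * T"
      using cd by (intro mult_right_mono) (auto simp: T_def)
    with 1 have "T \<le> 2 * d" by linarith
    moreover have "2 * d \<le> d\<^sup>2" using cd mult_right_mono[of 2 d d] by (simp add: power2_eq_square)
    moreover have "c\<^sup>2 \<le> d\<^sup>2" using cd by (intro power_mono) auto
    \<comment> \<open>Because \<open>2 \<le> d\<close>, the shift by 1 costs at most half of
      \<open>d\<close>.\<close>
    moreover have "(d / 2)\<^sup>2 \<le> (d - 1)\<^sup>2" using cd by (intro power_mono) auto
    ultimately have "c\<^sup>2 / 16 + T / 16 \<le> (d - 1)\<^sup>2 / 2"
      by (simp add: power_divide)
    then have "exp (- (d - 1)\<^sup>2 / 2) \<le> exp (- c\<^sup>2 / 16 + (- (1 / 16) * \<bar>real_of_int a\<bar> + - (1 / 16) * \<bar>real_of_int b\<bar>))"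
      by (simp add: T_def add_divide_distrib)
    also have "\<dots> = exp (- c\<^sup>2 / 16) * (x a * x b)"
      unfolding x_def exp_add ..
    finally show ?thesis by (simp add: \<phi>_def a_def b_def c_def d_def)
  qed
  define I J where "I = fst ` \<phi> ` Q" and "J = snd ` \<phi> ` Q"
  have fin: "finite I" "finite J" using assms(1) by (auto simp: I_def J_def)
  have "(\<Sum>q\<in>Q. exp (- (s * dist q z - 1)\<^sup>2 / 2)) \<le>
      (\<Sum>q\<in>Q. exp (- (s * C)\<^sup>2 / 16) * (case \<phi> q of (a, b) \<Rightarrow> x a * x b))"
    by (rule sum_mono) (rule weight_le)
  also have "\<dots> = exp (- (s * C)\<^sup>2 / 16) * (\<Sum>p\<in>\<phi> ` Q. case p of (a, b) \<Rightarrow> x a * x b)"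
    unfolding sum_distrib_left sum.reindex[OF inj] o_def ..
  also have "\<dots> \<le> exp (- (s * C)\<^sup>2 / 16) * (\<Sum>p\<in>I \<times> J. case p of (a, b) \<Rightarrow> x a * x b)"
  proof (intro mult_left_mono sum_mono2)
    show "\<phi> ` Q \<subseteq> I \<times> J" unfolding I_def J_def by (rule subset_fst_snd)
  qed (use fin in \<open>auto simp: x_def\<close>)
  also have "(\<Sum>p\<in>I \<times> J. case p of (a, b) \<Rightarrow> x a * x b) = sum x I * sum x J"
    by (simp add: sum_product sum.cartesian_product)
  also have "sum x I * sum x J \<le> lattice_const"
    unfolding lattice_const_def power2_eq_square x_def
    using fin by (intro mult_mono sum_exp_neg_abs_int sum_nonneg) auto
  finally show ?thesis by simp
qed

text \<open>Radii are unbounded, so the centres are not the right points to count. The boundary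
  points nearest to \<open>z\<close> carry the same weights and are uniformly separated, which
  reduces the sum to \<open>separated_gauss_sum\<close>.\<close>

lemma disc_weight_sum_far:
  assumes \<alpha>: "0 < \<alpha>" and fin: "finite L" and C: "2 \<le> sqrt \<alpha> * C"
    and disj: "disjoint_family_on (\<lambda>l. ball l (sqrt (m l / \<alpha>) + C)) L"
    and far: "\<And>l. l \<in> L \<Longrightarrow> sqrt (m l / \<alpha>) + C \<le> dist z l"
  shows "(\<Sum>l\<in>L. disc_weight \<alpha> l (m l) z) \<le> exp (- (sqrt \<alpha> * C)\<^sup>2 / 16) * lattice_const"
proof -
  define r where "r = (\<lambda>l. sqrt (m l / \<alpha>))"
  have r0: "0 \<le> r l" for l using \<alpha> by (simp add: r_def)
  have "0 < sqrt \<alpha> * C" using C by linarith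
  then have C0: "0 < C" using \<alpha> by (simp add: zero_less_mult_iff)
  \<comment> \<open>The point of the disc around \<open>l\<close> that is nearest to \<open>z\<close>: the ball of radius \<open>C\<close> around it
    still lies in the enlarged disc.\<close>
  define q where "q = (\<lambda>l. l + of_real (r l / dist z l) * (z - l))"
  have pos: "0 < dist z l" if "l \<in> L" for l
    using far[OF that] r0[of l] C0 unfolding r_def by linarith
  have ql: "dist (q l) l = r l" if "l \<in> L" for l
    using pos[OF that] r0[of l] by (simp add: q_def dist_norm norm_mult norm_divide)
  have qz: "dist (q l) z = dist z l - r l" if "l \<in> L" for l
  proof -
    have "q l - z = of_real (r l / dist z l - 1) * (z - l)" by (simp add: q_def algebra_simps)
    then have "dist (q l) z = \<bar>r l / dist z l - 1\<bar> * dist z l"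
      by (simp only: dist_norm norm_mult norm_of_real)
    also have "\<dots> = dist z l - r l"
      using far[OF that] pos[OF that] C0 by (simp add: r_def abs_if field_simps)
    finally show ?thesis .
  qed
  \<comment> \<open>Otherwise the midpoint of two nearest points would lie in both enlarged
    discs.\<close>
  have sep: "2 * C \<le> dist (q l) (q l')" if l: "l \<in> L" "l' \<in> L" "l \<noteq> l'" for l l'
  proof (rule ccontr)
    assume "\<not> 2 * C \<le> dist (q l) (q l')"
    then have *: "dist (midpoint (q l) (q l')) (q l) < C" "dist (midpoint (q l) (q l')) (q l') < C"
      by (auto simp: dist_midpoint)
    have "midpoint (q l) (q l') \<in> ball l (r l + C)" "midpoint (q l) (q l') \<in> ball l' (r l' + C)"
      using * ql[OF l(1)] ql[OF l(2)] dist_triangle[of "midpoint (q l) (q l')" l "q l"]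
        dist_triangle[of "midpoint (q l) (q l')" l' "q l'"]
      by (auto simp: mem_ball dist_commute)
    then show False using disj l unfolding disjoint_family_on_def r_def by blast
  qed
  have inj: "inj_on q L"
    using sep C0 by (fastforce simp: inj_on_def)
  have "(\<Sum>l\<in>L. disc_weight \<alpha> l (m l) z) = (\<Sum>l\<in>L. exp (- (sqrt \<alpha> * dist (q l) z - 1)\<^sup>2 / 2))"
  proof (rule sum.cong[OF refl])
    fix l assume l: "l \<in> L"
    have "C \<le> dist z l - r l" using far[OF l] by (simp add: r_def)
    \<comment> \<open>Hence the cut-off at 0 in \<open>disc_weight\<close> is inactive.\<close>
    then have "2 \<le> sqrt \<alpha> * (dist z l - r l)" using C \<alpha> by (meson mult_left_mono order_trans real_sqrt_ge_zero less_imp_le)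
    then show "disc_weight \<alpha> l (m l) z = exp (- (sqrt \<alpha> * dist (q l) z - 1)\<^sup>2 / 2)"
      unfolding disc_weight_def qz[OF l] by (simp add: r_def)
  qed
  also have "\<dots> = (\<Sum>q\<in>q ` L. exp (- (sqrt \<alpha> * dist q z - 1)\<^sup>2 / 2))"
    by (simp add: sum.reindex[OF inj])
  also have "\<dots> \<le> exp (- (sqrt \<alpha> * C)\<^sup>2 / 16) * lattice_const"
    by (rule separated_gauss_sum) (use fin C C0 \<alpha> sep far qz in \<open>force simp: r_def\<close>)+
  finally show ?thesis .
qed

section \<open>Separated discs\<close>

lemma fock_le_pointwise_limit:
  assumes "f holomorphic_on UNIV" "\<And>z. (\<lambda>n. g n z) \<longlonglongrightarrow> f z" "\<And>n. N \<le> n \<Longrightarrow> fock_le \<alpha> K (g n)"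
  shows "fock_le \<alpha> K f"
proof (rule fock_leI[OF assms(1)])
  fix z
  show "norm (f z) \<le> K * exp (\<alpha> / 2 * (norm z)\<^sup>2)"
  proof (rule LIMSEQ_le_const2)
    show "(\<lambda>n. norm (g n z)) \<longlonglongrightarrow> norm (f z)" by (intro tendsto_norm assms(2))
    show "\<exists>N. \<forall>n\<ge>N. norm (g n z) \<le> K * exp (\<alpha> / 2 * (norm z)\<^sup>2)"
      using fock_le_bound[OF assms(3)] by blast
  qed
qed

text \<open>A Fock bound is uniform on compact sets, so Montel's theorem applies, and the bound
  survives pointwise limits.\<close>

lemma fock_Montel:
  assumes \<alpha>: "0 < \<alpha>" and f: "\<And>n. fock_le \<alpha> K (f n)"
  shows "\<exists>g r. fock_le \<alpha> K g \<and> strict_mono (r :: nat \<Rightarrow> nat) \<and>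
    (\<forall>z. (\<lambda>n. f (r n) z) \<longlonglongrightarrow> g z) \<and> (\<forall>S. compact S \<longrightarrow> uniform_limit S (f \<circ> r) g sequentially)"
proof -
  have bound: "\<exists>B. \<forall>h\<in>{h. fock_le \<alpha> K h}. \<forall>z\<in>S. norm (h z) \<le> B" if S: "compact S" for S
  proof -
    obtain R where R: "\<And>z. z \<in> S \<Longrightarrow> norm z \<le> R" using compact_imp_bounded[OF S] by (auto simp: bounded_iff)
    have "norm (h z) \<le> K * exp (\<alpha> / 2 * R\<^sup>2)" if "fock_le \<alpha> K h" "z \<in> S" for h z
    proof -
      have "K * exp (\<alpha> / 2 * (norm z)\<^sup>2) \<le> K * exp (\<alpha> / 2 * R\<^sup>2)"
        using \<alpha> R[OF that(2)] fock_le_nonneg[OF that(1)] by (intro mult_left_mono) (auto intro!: mult_left_mono power_mono)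
      with fock_le_bound[OF that(1)] show ?thesis by (rule order_trans)
    qed
    then show ?thesis by blast
  qed
  obtain g r where g: "g holomorphic_on UNIV" "strict_mono (r :: nat \<Rightarrow> nat)"
    "\<And>z. z \<in> UNIV \<Longrightarrow> ((\<lambda>n. f (r n) z) \<longlongrightarrow> g z) sequentially"
    "\<And>S. \<lbrakk>compact S; S \<subseteq> UNIV\<rbrakk> \<Longrightarrow> uniform_limit S (f \<circ> r) g sequentially"
  proof (rule Montel[of UNIV "{h. fock_le \<alpha> K h}" f])
    show "range f \<subseteq> {h. fock_le \<alpha> K h}" using f by auto
  qed (use fock_le_holo bound in auto)
  have "fock_le \<alpha> K g"
    by (rule fock_le_pointwise_limit[OF g(1), of "\<lambda>n. f (r n)" 0]) (use g(3) f in auto)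
  with g show ?thesis by (intro exI[of _ g] exI[of _ r]) auto
qed

text \<open>Derivatives at \<open>l\<close> converge along with the functions, so interpolation up
  to errors tending to 0 becomes exact with the same bound. The vanishing is required only
  eventually, so that nodes may enter one after another.\<close>

lemma interpolants_limit:
  assumes \<alpha>: "0 < \<alpha>" and f: "\<And>n. fock_le \<alpha> K (f n)"
    and F: "\<And>l. l \<in> L \<Longrightarrow> F l holomorphic_on UNIV"
    and H: "\<And>l n. l \<in> L \<Longrightarrow> fock_le \<alpha> (b n) (H n l)" and b: "b \<longlonglongrightarrow> 0"
    and van: "\<And>l. l \<in> L \<Longrightarrow> \<forall>\<^sub>F n in sequentially. vanishes_to (\<lambda>z. f n z + H n l z - F l z) l (m l)"
  obtains g where "fock_le \<alpha> K g" "\<And>l. l \<in> L \<Longrightarrow> vanishes_to (\<lambda>z. g z - F l z) l (m l)"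
proof -
  obtain g r where g: "fock_le \<alpha> K g" "strict_mono (r :: nat \<Rightarrow> nat)"
    "\<And>S. compact S \<Longrightarrow> uniform_limit S (f \<circ> r) g sequentially"
    using fock_Montel[where f = f, OF \<alpha> f] by blast
  have "vanishes_to (\<lambda>z. g z - F l z) l (m l)" if l: "l \<in> L" for l
  proof -
    let ?S = "cball l 1"
    let ?h = "\<lambda>n z. f (r n) z + H (r n) l z - F l z"
    have "uniform_limit ?S (\<lambda>n. H (r n) l) (\<lambda>_. 0) sequentially"
    proof (rule uniform_limitI)
      fix e :: real assume "0 < e"
      define E where "E = exp (\<alpha> / 2 * (norm l + 1)\<^sup>2)"
      have "(\<lambda>n. b (r n) * E) \<longlonglongrightarrow> 0 * E"
        using LIMSEQ_subseq_LIMSEQ[OF b g(2)] by (intro tendsto_mult tendsto_const) (simp add: o_def)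
      then have "\<forall>\<^sub>F n in sequentially. b (r n) * E < e"
        using \<open>0 < e\<close> by (simp add: order_tendstoD(2))
      then show "\<forall>\<^sub>F n in sequentially. \<forall>z\<in>?S. dist (H (r n) l z) 0 < e"
      proof (rule eventually_mono, intro ballI)
        fix n z assume n: "b (r n) * E < e" and z: "z \<in> ?S"
        have "norm z \<le> norm l + 1"
          using z norm_triangle_ineq[of l "z - l"] by (simp add: dist_norm norm_minus_commute)
        then have "exp (\<alpha> / 2 * (norm z)\<^sup>2) \<le> E"
          unfolding E_def using \<alpha> by (auto intro!: mult_left_mono power_mono)
        then have "b (r n) * exp (\<alpha> / 2 * (norm z)\<^sup>2) \<le> b (r n) * E"
          using fock_le_nonneg[OF H[OF l]] by (rule mult_left_mono)
        from le_less_trans[OF order_trans[OF fock_le_bound[OF H[OF l]] this] n]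
        show "dist (H (r n) l z) 0 < e" by simp
      qed
    qed
    then have "uniform_limit ?S ?h (\<lambda>z. g z + 0 - F l z) sequentially"
      using g(3)[of ?S] by (intro uniform_limit_minus uniform_limit_add uniform_limit_const) (auto simp: o_def)
    then have "uniform_limit (ball l 1) ?h (\<lambda>z. g z - F l z) sequentially"
      by (auto intro: uniform_limit_on_subset)
    moreover have "?h n holomorphic_on ball l 1" for n
      using fock_le_holo[OF f] fock_le_holo[OF H[OF l]] F[OF l]
      by (intro holomorphic_intros) (auto intro: holomorphic_on_subset)
    ultimately have lim: "(\<lambda>n. (deriv ^^ j) (?h n) l) \<longlonglongrightarrow> (deriv ^^ j) (\<lambda>z. g z - F l z) l" for j
      by (intro higher_deriv_complex_uniform_limit[where A = "ball l 1"]) auto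
    have "(deriv ^^ j) (\<lambda>z. g z - F l z) l = 0" if "j < m l" for j
    proof (rule LIMSEQ_unique[OF lim])
      have "\<forall>\<^sub>F n in sequentially. vanishes_to (?h n) l (m l)"
        using eventually_compose_filterlim[OF van[OF l] filterlim_subseq[OF g(2)]] .
      then have "\<forall>\<^sub>F n in sequentially. 0 = (deriv ^^ j) (?h n) l"
        by (rule eventually_mono) (use vanishes_to_deriv_zero that in metis)
      then show "(\<lambda>n. (deriv ^^ j) (?h n) l) \<longlonglongrightarrow> 0" by (rule Lim_transform_eventually[rotated]) simp
    qed
    moreover have "(\<lambda>z. g z - F l z) holomorphic_on UNIV"
      using fock_le_holo[OF g(1)] F[OF l] by (intro holomorphic_intros)
    ultimately show ?thesis by (simp add: vanishes_to_iff_deriv)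
  qed
  with g(1) that show ?thesis by blast
qed

section \<open>Interpolation up to a contraction, and its iteration\<close>

text \<open>Sum the local solutions. At most one enlarged disc contains a given \<open>z\<close>, so
  the weights total at most \<open>1 + \<delta>\<close>. Near the disc of \<open>k\<close> the other
  solutions are of order \<open>\<delta>\<close>, and local interpolation replaces their sum by a
  globally small function with the same jet, which up to sign is the residual
  \<open>G' k\<close>.\<close>

lemma approximate_interpolation:
  assumes \<alpha>: "0 < \<alpha>" and fin: "finite L" and C: "2 \<le> sqrt \<alpha> * C"
    and C_large: "exp (- (sqrt \<alpha> * C)\<^sup>2 / 16) * lattice_const \<le> \<delta>"
      "\<delta> \<le> 1" "local_const * local_const * \<delta> \<le> 1 / 2"
    and m: "\<And>l. l \<in> L \<Longrightarrow> 1 \<le> m l"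
    and disj: "disjoint_family_on (\<lambda>l. ball l (sqrt (m l / \<alpha>) + C)) L"
    and G: "\<And>l. l \<in> L \<Longrightarrow> fock_le \<alpha> \<epsilon> (G l)" and eps: "0 \<le> \<epsilon>"
  obtains f G' where "fock_le \<alpha> (2 * local_const * \<epsilon>) f"
    "\<And>l. l \<in> L \<Longrightarrow> fock_le \<alpha> (\<epsilon> / 2) (G' l)"
    "\<And>l. l \<in> L \<Longrightarrow> vanishes_to (\<lambda>z. f z + G' l z - G l z) l (m l)"
proof -
  define W where "W = (\<lambda>l z. disc_weight \<alpha> l (m l) z)"
  define E where "E = (\<lambda>z::complex. exp (\<alpha> / 2 * (norm z)\<^sup>2))"
  have E: "0 \<le> E z" for z by (simp add: E_def)
  have W: "0 \<le> W l z" "W l z \<le> 1" for l z by (auto simp: W_def disc_weight_le_1) (simp add: disc_weight_def)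
  have A: "0 < local_const" by (rule local_const_pos)
  have "\<exists>p. p holomorphic_on UNIV \<and> vanishes_to (\<lambda>z. G l z - p z) l (m l) \<and>
      (\<forall>z. norm (p z) \<le> local_const * \<epsilon> * W l z * E z)" if "l \<in> L" for l
    using fock_local_interpolation[OF \<alpha> fock_le_holo[OF G[OF that]] m[OF that] fock_le_bound[OF G[OF that]]]
    unfolding W_def E_def by blast
  then obtain p where p: "\<And>l. l \<in> L \<Longrightarrow> p l holomorphic_on UNIV"
    "\<And>l. l \<in> L \<Longrightarrow> vanishes_to (\<lambda>z. G l z - p l z) l (m l)"
    "\<And>l z. l \<in> L \<Longrightarrow> norm (p l z) \<le> local_const * \<epsilon> * W l z * E z"
    by metis
  have sum_bound: "norm (\<Sum>l\<in>J. p l z) \<le> local_const * \<epsilon> * B * E z"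
    if "J \<subseteq> L" "(\<Sum>l\<in>J. W l z) \<le> B" for J z B
  proof -
    have "norm (\<Sum>l\<in>J. p l z) \<le> (\<Sum>l\<in>J. local_const * \<epsilon> * W l z * E z)"
      using that(1) by (intro sum_norm_le p(3)) auto
    also have "\<dots> = local_const * \<epsilon> * E z * (\<Sum>l\<in>J. W l z)"
      by (simp add: sum_distrib_left mult_ac)
    also have "\<dots> \<le> local_const * \<epsilon> * E z * B"
      using that(2) A eps E by (intro mult_left_mono) auto
    finally show ?thesis by (simp add: mult_ac)
  qed
  have far: "(\<Sum>l\<in>J. W l z) \<le> \<delta>"
    if "J \<subseteq> L" "\<And>l. l \<in> J \<Longrightarrow> z \<notin> ball l (sqrt (m l / \<alpha>) + C)" for J z
    unfolding W_def
  proof (rule order_trans[OF disc_weight_sum_far[OF \<alpha> _ C] C_large(1)])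
    show "finite J" using that(1) fin by (rule finite_subset)
    show "disjoint_family_on (\<lambda>l. ball l (sqrt (m l / \<alpha>) + C)) J"
      using disj that(1) by (rule disjoint_family_on_mono[rotated])
  qed (use that(2) in \<open>auto simp: not_less dist_commute\<close>)
  define f where "f = (\<lambda>z. \<Sum>l\<in>L. p l z)"
  have f: "fock_le \<alpha> (2 * local_const * \<epsilon>) f"
  proof (rule fock_leI)
    show "f holomorphic_on UNIV" unfolding f_def by (intro holomorphic_intros p)
    fix z
    have "(\<Sum>l\<in>L. W l z) \<le> 2"
    proof (cases "\<exists>l\<in>L. z \<in> ball l (sqrt (m l / \<alpha>) + C)")
      case True
      then obtain l where l: "l \<in> L" "z \<in> ball l (sqrt (m l / \<alpha>) + C)" by blast
      have "z \<notin> ball l' (sqrt (m l' / \<alpha>) + C)" if "l' \<in> L - {l}" for l'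
        using l disj that unfolding disjoint_family_on_def by blast
      then have "(\<Sum>l\<in>L - {l}. W l z) \<le> \<delta>" by (intro far) auto
      then show ?thesis
        using sum.remove[OF fin l(1), of "\<lambda>l. W l z"] W(2)[of l z] C_large(2) by simp
    next
      case False
      then have "(\<Sum>l\<in>L. W l z) \<le> \<delta>" by (intro far) auto
      then show ?thesis using C_large(2) by simp
    qed
    from sum_bound[OF subset_refl this] show "norm (f z) \<le> 2 * local_const * \<epsilon> * exp (\<alpha> / 2 * (norm z)\<^sup>2)"
      unfolding f_def E_def by (simp add: mult_ac)
  qed
  have "\<exists>q. fock_le \<alpha> (\<epsilon> / 2) q \<and> vanishes_to (\<lambda>z. f z - q z - G k z) k (m k)" if k: "k \<in> L" for k
  proof -
    define g where "g = (\<lambda>z. \<Sum>l\<in>L - {k}. p l z)"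
    have g: "g holomorphic_on UNIV" unfolding g_def using p(1) by (intro holomorphic_intros) auto
    have b: "norm (g z) \<le> local_const * \<epsilon> * \<delta> * exp (\<alpha> / 2 * (norm z)\<^sup>2)"
      if z: "dist z k \<le> sqrt (m k / \<alpha>) + 1 / sqrt \<alpha>" for z
    proof -
      \<comment> \<open>The margin \<open>1 / sqrt \<alpha>\<close> required by the local lemma
        stays inside the enlarged disc of \<open>k\<close>.\<close>
      have "1 < C * sqrt \<alpha>" using C by (simp add: mult.commute)
      then have "1 / sqrt \<alpha> < C" using \<alpha> by (simp add: divide_less_eq)
      then have "z \<in> ball k (sqrt (m k / \<alpha>) + C)" using z by (simp add: dist_commute)
      then have "z \<notin> ball l (sqrt (m l / \<alpha>) + C)" if "l \<in> L - {k}" for l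
        using k disj that unfolding disjoint_family_on_def by blast
      then have "(\<Sum>l\<in>L - {k}. W l z) \<le> \<delta>" by (intro far) auto
      from sum_bound[OF _ this] show ?thesis unfolding g_def E_def by auto
    qed
    obtain q where q: "q holomorphic_on UNIV" "vanishes_to (\<lambda>z. g z - q z) k (m k)"
      "\<And>z. norm (q z) \<le> local_const * (local_const * \<epsilon> * \<delta>) * disc_weight \<alpha> k (m k) z * exp (\<alpha> / 2 * (norm z)\<^sup>2)"
      using fock_local_interpolation[OF \<alpha> g m[OF k] b, where thesis = thesis] by blast
    have "fock_le \<alpha> (\<epsilon> / 2) q"
    proof (rule fock_leI[OF q(1)])
      fix z
      have "0 \<le> \<delta>"
        using C_large(1) by (rule order_trans[rotated]) (simp add: lattice_const_def)
      then have "local_const * (local_const * \<epsilon> * \<delta>) * disc_weight \<alpha> k (m k) z \<le>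
          local_const * (local_const * \<epsilon> * \<delta>) * 1"
        using A eps by (intro mult_left_mono disc_weight_le_1) auto
      also have "\<dots> = (local_const * local_const * \<delta>) * \<epsilon>" by simp
      also have "\<dots> \<le> 1 / 2 * \<epsilon>" using C_large(3) eps by (rule mult_right_mono)
      finally have "local_const * (local_const * \<epsilon> * \<delta>) * disc_weight \<alpha> k (m k) z * exp (\<alpha> / 2 * (norm z)\<^sup>2)
          \<le> 1 / 2 * \<epsilon> * exp (\<alpha> / 2 * (norm z)\<^sup>2)" by (rule mult_right_mono) simp
      with q(3)[of z] show "norm (q z) \<le> \<epsilon> / 2 * exp (\<alpha> / 2 * (norm z)\<^sup>2)" by simp
    qed
    \<comment> \<open>As \<open>f = g + p k\<close>, this is \<open>f - q - G k\<close>
      regrouped.\<close>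
    moreover have "vanishes_to (\<lambda>z. (g z - q z) - (G k z - p k z)) k (m k)"
      by (rule vanishes_to_diff[OF q(2) p(2)[OF k]])
    then have "vanishes_to (\<lambda>z. f z - q z - G k z) k (m k)"
      unfolding f_def g_def using sum.remove[OF fin k, of "\<lambda>l. p l _"] by (simp add: algebra_simps)
    ultimately show ?thesis by blast
  qed
  then obtain q where "\<And>k. k \<in> L \<Longrightarrow> fock_le \<alpha> (\<epsilon> / 2) (q k)"
    "\<And>k. k \<in> L \<Longrightarrow> vanishes_to (\<lambda>z. f z - q k z - G k z) k (m k)" by metis
  then show ?thesis
    by (intro that[of f "\<lambda>k z. - q k z"] f fock_le_minus) auto
qed

text \<open>Each pass treats the residual of the previous one as new data. The corrections form a
  geometric series, whose partial sums give the factor \<open>1 - (1 / 2) ^ n\<close>.\<close>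

lemma iterated_interpolation:
  assumes \<alpha>: "0 < \<alpha>" and fin: "finite L" and C: "2 \<le> sqrt \<alpha> * C"
    and C_large: "exp (- (sqrt \<alpha> * C)\<^sup>2 / 16) * lattice_const \<le> \<delta>"
      "\<delta> \<le> 1" "local_const * local_const * \<delta> \<le> 1 / 2"
    and m: "\<And>l. l \<in> L \<Longrightarrow> 1 \<le> m l"
    and disj: "disjoint_family_on (\<lambda>l. ball l (sqrt (m l / \<alpha>) + C)) L"
    and G: "\<And>l. l \<in> L \<Longrightarrow> fock_le \<alpha> \<epsilon> (G l)" and eps: "0 \<le> \<epsilon>"
  shows "\<exists>f H. fock_le \<alpha> (4 * local_const * \<epsilon> * (1 - (1 / 2) ^ n)) f \<and>
    (\<forall>l\<in>L. fock_le \<alpha> (\<epsilon> * (1 / 2) ^ n) (H l) \<and> vanishes_to (\<lambda>z. f z + H l z - G l z) l (m l))"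
proof (induction n)
  case 0
  show ?case using G vanishes_to_0 by (intro exI[of _ "\<lambda>z. 0"] exI[of _ G]) auto
next
  case (Suc n)
  then obtain f H where f: "fock_le \<alpha> (4 * local_const * \<epsilon> * (1 - (1 / 2) ^ n)) f"
    and H: "\<And>l. l \<in> L \<Longrightarrow> fock_le \<alpha> (\<epsilon> * (1 / 2) ^ n) (H l)"
    and van: "\<And>l. l \<in> L \<Longrightarrow> vanishes_to (\<lambda>z. f z + H l z - G l z) l (m l)" by blast
  obtain f' H' where f': "fock_le \<alpha> (2 * local_const * (\<epsilon> * (1 / 2) ^ n)) f'"
    and H': "\<And>l. l \<in> L \<Longrightarrow> fock_le \<alpha> (\<epsilon> * (1 / 2) ^ n / 2) (H' l)"
    and van': "\<And>l. l \<in> L \<Longrightarrow> vanishes_to (\<lambda>z. f' z + H' l z - H l z) l (m l)"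
    using approximate_interpolation[OF \<alpha> fin C C_large m disj, where G = H and \<epsilon> = "\<epsilon> * (1 / 2) ^ n" and thesis = thesis] H eps by auto
  have "fock_le \<alpha> (4 * local_const * \<epsilon> * (1 - (1 / 2) ^ Suc n)) (\<lambda>z. f z + f' z)"
    by (rule fock_le_mono[OF fock_le_add[OF f f']]) (simp add: algebra_simps)
  moreover have "vanishes_to (\<lambda>z. (f z + f' z) + H' l z - G l z) l (m l)" if "l \<in> L" for l
    using vanishes_to_add[OF van[OF that] van'[OF that]] by (simp add: algebra_simps)
  ultimately show ?case using H' by (intro exI[of _ "\<lambda>z. f z + f' z"] exI[of _ H']) auto
qed

text \<open>Running \<open>n\<close> passes on the first \<open>n\<close> nodes avoids infinite
  sums. The residuals tend to 0 and every node is eventually included, so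
  \<open>interpolants_limit\<close> finishes.\<close>

lemma separated_interpolation:
  assumes \<alpha>: "0 < \<alpha>" and L: "countable L" and C: "2 \<le> sqrt \<alpha> * C"
    and C_large: "exp (- (sqrt \<alpha> * C)\<^sup>2 / 16) * lattice_const \<le> \<delta>"
      "\<delta> \<le> 1" "local_const * local_const * \<delta> \<le> 1 / 2"
    and m: "\<And>l. l \<in> L \<Longrightarrow> 1 \<le> m l"
    and disj: "disjoint_family_on (\<lambda>l. ball l (sqrt (m l / \<alpha>) + C)) L"
    and G: "\<And>l. l \<in> L \<Longrightarrow> fock_le \<alpha> \<epsilon> (G l)" and eps: "0 \<le> \<epsilon>"
  obtains f where "fock_le \<alpha> (4 * local_const * \<epsilon>) f"
    "\<And>l. l \<in> L \<Longrightarrow> vanishes_to (\<lambda>z. f z - G l z) l (m l)"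
proof -
  define e where "e = to_nat_on L"
  have e: "inj_on e L" using L by (simp add: e_def inj_on_to_nat_on)
  define Ln where "Ln = (\<lambda>n. {l \<in> L. e l < n})"
  have fin: "finite (Ln n)" for n
    by (rule inj_on_finite[of e _ "{..<n}"]) (use e in \<open>auto simp: Ln_def inj_on_def\<close>)
  have "\<exists>f H. fock_le \<alpha> (4 * local_const * \<epsilon>) f \<and>
    (\<forall>l\<in>Ln n. fock_le \<alpha> (\<epsilon> * (1 / 2) ^ n) (H l) \<and> vanishes_to (\<lambda>z. f z + H l z - G l z) l (m l))" for n
  proof -
    have "disjoint_family_on (\<lambda>l. ball l (sqrt (m l / \<alpha>) + C)) (Ln n)"
      using disj by (rule disjoint_family_on_mono[rotated]) (auto simp: Ln_def)
    moreover have "1 \<le> m l" "fock_le \<alpha> \<epsilon> (G l)" if "l \<in> Ln n" for l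
      using that m G by (auto simp: Ln_def)
    ultimately obtain f H where fH: "fock_le \<alpha> (4 * local_const * \<epsilon> * (1 - (1 / 2) ^ n)) f"
      "\<forall>l\<in>Ln n. fock_le \<alpha> (\<epsilon> * (1 / 2) ^ n) (H l) \<and> vanishes_to (\<lambda>z. f z + H l z - G l z) l (m l)"
      using iterated_interpolation[where L = "Ln n" and m = m and G = G and \<epsilon> = \<epsilon> and n = n, OF \<alpha> fin C C_large] eps
      by blast
    have "4 * local_const * \<epsilon> * (1 - (1 / 2) ^ n) \<le> 4 * local_const * \<epsilon> * 1"
      using local_const_pos eps by (intro mult_left_mono) auto
    with fH show ?thesis using fock_le_mono by fastforce
  qed
  then obtain f H where f: "\<And>n. fock_le \<alpha> (4 * local_const * \<epsilon>) (f n)"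
    and H: "\<And>n l. l \<in> Ln n \<Longrightarrow> fock_le \<alpha> (\<epsilon> * (1 / 2) ^ n) (H n l)"
    and van: "\<And>n l. l \<in> Ln n \<Longrightarrow> vanishes_to (\<lambda>z. f n z + H n l z - G l z) l (m l)"
    by metis
  \<comment> \<open>The value 0 supplies the norm bound also at nodes not yet reached.\<close>
  define H' where "H' = (\<lambda>n l. if l \<in> Ln n then H n l else (\<lambda>z. 0))"
  have lim: "(\<lambda>n. \<epsilon> * (1 / 2) ^ n) \<longlonglongrightarrow> \<epsilon> * 0"
    by (intro tendsto_mult tendsto_const LIMSEQ_power_zero) auto
  show ?thesis
  proof (rule interpolants_limit[OF \<alpha> f, where L = L and F = G and b = "\<lambda>n. \<epsilon> * (1 / 2) ^ n" and H = H' and m = m])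
    show "G l holomorphic_on UNIV" if "l \<in> L" for l using G[OF that] by (rule fock_le_holo)
    show "fock_le \<alpha> (\<epsilon> * (1 / 2) ^ n) (H' n l)" if "l \<in> L" for l n
      using H eps by (auto simp: H'_def)
    show "(\<lambda>n. \<epsilon> * (1 / 2) ^ n) \<longlonglongrightarrow> 0" using lim by simp
    show "\<forall>\<^sub>F n in sequentially. vanishes_to (\<lambda>z. f n z + H' n l z - G l z) l (m l)" if "l \<in> L" for l
      using eventually_gt_at_top[of "e l"]
      by (rule eventually_mono) (use van that in \<open>auto simp: H'_def Ln_def\<close>)
  qed (use that in blast)
qed

section \<open>The interpolation constant\<close>

text \<open>A quantitative \<open>interpolates\<close>: the bound \<open>K\<close> is recorded, and
  of \<open>f - F l\<close> only the vanishing is asked, so \<open>F\<close> may be any family of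
  functions.\<close>

definition solves ::
  "real \<Rightarrow> complex set \<Rightarrow> (complex \<Rightarrow> nat) \<Rightarrow> real \<Rightarrow> (complex \<Rightarrow> complex \<Rightarrow> complex) \<Rightarrow> (complex \<Rightarrow> complex) \<Rightarrow> bool"
  where "solves \<alpha> L m K F f \<longleftrightarrow> fock_le \<alpha> K f \<and> (\<forall>l\<in>L. vanishes_to (\<lambda>z. f z - F l z) l (m l))"

lemma solves_mono: "solves \<alpha> L m K F f \<Longrightarrow> K \<le> K' \<Longrightarrow> solves \<alpha> L m K' F f"
  by (auto simp: solves_def intro: fock_le_mono)

lemma solves_lincomb:
  assumes "solves \<alpha> L m K F f" "solves \<alpha> L m K' F' f'"
  shows "solves \<alpha> L m (norm c * (K + K')) (\<lambda>l z. c * (F l z - F' l z)) (\<lambda>z. c * (f z - f' z))"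
  unfolding solves_def
proof (intro conjI ballI)
  show "fock_le \<alpha> (norm c * (K + K')) (\<lambda>z. c * (f z - f' z))"
    using assms unfolding solves_def by (intro fock_le_cmult fock_le_diff) auto
  fix l assume "l \<in> L"
  then have "vanishes_to (\<lambda>z. f z - F l z) l (m l)" "vanishes_to (\<lambda>z. f' z - F' l z) l (m l)"
    using assms unfolding solves_def by auto
  from vanishes_to_cmult[OF vanishes_to_diff[OF this]]
  have "vanishes_to (\<lambda>z. c * ((f z - F l z) - (f' z - F' l z))) l (m l)" .
  moreover have "c * ((f z - F l z) - (f' z - F' l z)) = c * (f z - f' z) - c * (F l z - F' l z)" for z
    by (simp add: algebra_simps)
  ultimately show "vanishes_to (\<lambda>z. c * (f z - f' z) - c * (F l z - F' l z)) l (m l)"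
    by simp
qed

lemma solves_equivalent_data:
  assumes "solves \<alpha> L m K G f" "\<And>l. l \<in> L \<Longrightarrow> vanishes_to (\<lambda>z. F l z - G l z) l (m l)"
  shows "solves \<alpha> L m K F f"
  unfolding solves_def
proof (intro conjI ballI)
  show "fock_le \<alpha> K f" using assms(1) by (simp add: solves_def)
  fix l assume l: "l \<in> L"
  then have "vanishes_to (\<lambda>z. f z - G l z) l (m l)"
    using assms(1) unfolding solves_def by auto
  from vanishes_to_diff[OF this assms(2)[OF l]] show "vanishes_to (\<lambda>z. f z - F l z) l (m l)" by simp
qed

lemma solves_interpolates:
  assumes "solves \<alpha> L m K F f" "\<And>l. l \<in> L \<Longrightarrow> F l \<in> fock_space \<alpha>"
  shows "interpolates \<alpha> L m F f" "fock_norm \<alpha> f \<le> K"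
proof -
  have f: "fock_le \<alpha> K f" using assms(1) by (simp add: solves_def)
  then show "fock_norm \<alpha> f \<le> K" by (rule fock_norm_le)
  have "(\<lambda>z. f z - F l z) \<in> fock_space \<alpha>" if "l \<in> L" for l
    using fock_le_diff[OF f fock_space_fock_norm[OF assms(2)[OF that]]] by (rule fock_le_fock_space)
  then show "interpolates \<alpha> L m F f"
    using assms(1) fock_le_fock_space[OF f] by (simp add: interpolates_def vanishing_iff solves_def)
qed

lemma interpolates_solves:
  assumes "interpolates \<alpha> L m F f" "fock_norm \<alpha> f \<le> K"
  shows "solves \<alpha> L m K F f"
  using assms fock_le_mono[OF fock_space_fock_norm assms(2)]
  by (auto simp: solves_def interpolates_def vanishing_iff)

lemma admissible_dataI:
  assumes "\<And>l. l \<in> L \<Longrightarrow> fock_le \<alpha> B (F l)" "0 \<le> B"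
  shows "admissible_data \<alpha> L m F" "data_norm \<alpha> L m F \<le> B"
proof -
  show "admissible_data \<alpha> L m F"
    unfolding admissible_data_def
  proof (intro conjI ballI bdd_aboveI2)
    show "F l \<in> fock_space \<alpha>" "quotient_norm \<alpha> l (m l) (F l) \<le> B" if "l \<in> L" for l
      using assms(1)[OF that] by (rule fock_le_fock_space, rule quotient_norm_le)
  qed
  show "data_norm \<alpha> L m F \<le> B"
    unfolding data_norm_def using assms quotient_norm_le by (intro cSup_least) auto
qed

lemma admissible_data_bdd:
  assumes "admissible_data \<alpha> L m F"
  shows "bdd_above (insert 0 ((\<lambda>l. quotient_norm \<alpha> l (m l) (F l)) ` L))"
  using assms by (simp add: admissible_data_def)

lemma data_norm_nonneg:
  assumes "admissible_data \<alpha> L m F"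
  shows "0 \<le> data_norm \<alpha> L m F"
  unfolding data_norm_def by (rule cSup_upper[OF _ admissible_data_bdd[OF assms]]) simp

lemma admissible_data_representatives:
  assumes F: "admissible_data \<alpha> L m F" and B: "data_norm \<alpha> L m F < B"
  shows "\<exists>G. \<forall>l\<in>L. fock_le \<alpha> B (G l) \<and> vanishes_to (\<lambda>z. F l z - G l z) l (m l)"
proof -
  have "\<exists>g. fock_le \<alpha> B g \<and> vanishes_to (\<lambda>z. F l z - g z) l (m l)" if "l \<in> L" for l
  proof -
    have "quotient_norm \<alpha> l (m l) (F l) \<le> data_norm \<alpha> L m F"
      unfolding data_norm_def by (rule cSup_upper[OF _ admissible_data_bdd[OF F]]) (use that in auto)
    with B have "quotient_norm \<alpha> l (m l) (F l) < B" by simp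
    moreover have "F l \<in> fock_space \<alpha>" using F that by (simp add: admissible_data_def)
    ultimately show ?thesis using quotient_norm_less by blast
  qed
  then show ?thesis by metis
qed

section \<open>Uniform solvability by a gliding hump\<close>

text \<open>By compactness: solutions for perturbations of size \<open>1 / (n + 1)\<close> would
  accumulate at a solution for \<open>F\<close> itself.\<close>

lemma not_solvable_open:
  assumes \<alpha>: "0 < \<alpha>" and F: "\<And>l. l \<in> L \<Longrightarrow> F l holomorphic_on UNIV"
    and no: "\<And>f. \<not> solves \<alpha> L m K F f"
  shows "\<exists>d>0. \<forall>G f. (\<forall>l\<in>L. fock_le \<alpha> d (G l)) \<longrightarrow> \<not> solves \<alpha> L m K (\<lambda>l z. F l z + G l z) f"
proof (rule ccontr)
  assume "\<not> ?thesis"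
  then have "\<exists>G f. (\<forall>l\<in>L. fock_le \<alpha> (inverse (real (Suc n))) (G l)) \<and>
      solves \<alpha> L m K (\<lambda>l z. F l z + G l z) f" for n
    by (meson inverse_positive_iff_positive of_nat_0_less_iff zero_less_Suc)
  then obtain G f where G: "\<And>n l. l \<in> L \<Longrightarrow> fock_le \<alpha> (inverse (real (Suc n))) (G n l)"
    and f: "\<And>n. solves \<alpha> L m K (\<lambda>l z. F l z + G n l z) (f n)" by metis
  obtain g where "fock_le \<alpha> K g" "\<And>l. l \<in> L \<Longrightarrow> vanishes_to (\<lambda>z. g z - F l z) l (m l)"
  proof (rule interpolants_limit[where \<alpha> = \<alpha> and K = K and f = f and L = L and F = F and m = m
        and b = "\<lambda>n. inverse (real (Suc n))" and H = "\<lambda>n l z. - G n l z"])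
    show "\<forall>\<^sub>F n in sequentially. vanishes_to (\<lambda>z. f n z + - G n l z - F l z) l (m l)" if "l \<in> L" for l
      using f that by (auto simp: solves_def algebra_simps)
  qed (use \<alpha> F f G LIMSEQ_inverse_real_of_nat in \<open>auto simp: solves_def intro: fock_le_minus\<close>)
  then show False using no by (auto simp: solves_def)
qed

lemma interpolating_solvable:
  assumes "interpolating \<alpha> L m" "\<And>l. l \<in> L \<Longrightarrow> fock_le \<alpha> B (F l)" "0 \<le> B"
  shows "\<exists>K f. solves \<alpha> L m K F f"
proof -
  obtain f where "interpolates \<alpha> L m F f"
    using assms(1) admissible_dataI(1)[where F = F, OF assms(2,3)] unfolding interpolating_def by blast
  then have "solves \<alpha> L m (fock_norm \<alpha> f) F f" by (rule interpolates_solves) simp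
  then show ?thesis by blast
qed

text \<open>Adding or subtracting a multiple of badly solvable data leaves the set of data solvable
  with constant \<open>K\<close>, and openness preserves this on a ball around \<open>y\<close>.
  Both steps of \<open>d / 2\<close> keep that ball within distance \<open>d\<close> of
  \<open>x\<close>.\<close>

lemma gliding_hump_step:
  assumes \<alpha>: "0 < \<alpha>"
    and unb: "\<And>K. \<exists>F. (\<forall>l\<in>L. fock_le \<alpha> 1 (F l)) \<and> (\<forall>f. \<not> solves \<alpha> L m K F f)"
    and x: "\<And>l. l \<in> L \<Longrightarrow> fock_le \<alpha> B (x l)" and d: "0 < d"
  shows "\<exists>y d'. 0 < d' \<and> d' \<le> d / 2 \<and> (\<forall>l\<in>L. fock_le \<alpha> (d / 2) (\<lambda>z. y l z - x l z)) \<and>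
    (\<forall>G f. (\<forall>l\<in>L. fock_le \<alpha> d' (G l)) \<longrightarrow> \<not> solves \<alpha> L m K (\<lambda>l z. y l z + G l z) f)"
proof -
  obtain F where F: "\<And>l. l \<in> L \<Longrightarrow> fock_le \<alpha> 1 (F l)" "\<And>f. \<not> solves \<alpha> L m (2 * K / d) F f"
    using unb[of "2 * K / d"] by blast
  \<comment> \<open>Interpolants of norm at most \<open>K\<close> for both \<open>x + d F / 2\<close> and \<open>x - d F / 2\<close> would give one
    of norm at most \<open>2 K / d\<close> for \<open>F\<close>.\<close>
  have "\<exists>s\<in>{d / 2, - d / 2}. \<forall>f. \<not> solves \<alpha> L m K (\<lambda>l z. x l z + of_real s * F l z) f"
  proof (rule ccontr)
    assume "\<not> ?thesis"
    then obtain f f' where "solves \<alpha> L m K (\<lambda>l z. x l z + of_real (d / 2) * F l z) f"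
      "solves \<alpha> L m K (\<lambda>l z. x l z + of_real (- d / 2) * F l z) f'" by auto
    note sol = solves_lincomb[OF this, of "of_real (1 / d)"]
    have "norm (of_real (1 / d) :: complex) * (K + K) = 2 * K / d"
      using d unfolding norm_of_real by simp
    moreover have "(\<lambda>l z. of_real (1 / d) * ((x l z + of_real (d / 2) * F l z) -
        (x l z + of_real (- d / 2) * F l z))) = F"
      using d by (auto simp: fun_eq_iff field_simps)
    ultimately have "solves \<alpha> L m (2 * K / d) F (\<lambda>z. of_real (1 / d) * (f z - f' z))"
      using sol by (simp only:)
    with F(2) show False by blast
  qed
  then obtain s where "s \<in> {d / 2, - d / 2}"
    and no_s: "\<And>f. \<not> solves \<alpha> L m K (\<lambda>l z. x l z + of_real s * F l z) f" by blast
  then have s: "\<bar>s\<bar> = d / 2" using d by auto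
  define y where "y = (\<lambda>l z. x l z + of_real s * F l z)"
  have yx: "fock_le \<alpha> (d / 2) (\<lambda>z. y l z - x l z)" if "l \<in> L" for l
    using fock_le_cmult[OF F(1)[OF that], of "of_real s"]
    unfolding norm_of_real s y_def by simp
  have hy: "y l holomorphic_on UNIV" if "l \<in> L" for l
    unfolding y_def using fock_le_holo[OF x[OF that]] fock_le_holo[OF F(1)[OF that]] by (intro holomorphic_intros)
  have no: "\<not> solves \<alpha> L m K y f" for f unfolding y_def by (rule no_s)
  obtain e where e: "e > 0"
    "\<And>G f. \<forall>l\<in>L. fock_le \<alpha> e (G l) \<Longrightarrow> \<not> solves \<alpha> L m K (\<lambda>l z. y l z + G l z) f"
    using not_solvable_open[where F = y and L = L and m = m and K = K, OF \<alpha> hy no] by blast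
  have "\<not> solves \<alpha> L m K (\<lambda>l z. y l z + G l z) f"
    if "\<forall>l\<in>L. fock_le \<alpha> (min e (d / 2)) (G l)" for G f
    using that by (intro e(2)) (auto intro: fock_le_mono)
  moreover have "0 < min e (d / 2)" "min e (d / 2) \<le> d / 2" using e(1) d by auto
  ultimately show ?thesis using yx by blast
qed

text \<open>Without a uniform constant, the humps converge to bounded data \<open>y\<close> lying in
  the unsolvable ball of every stage \<open>n\<close>. Such data admit no interpolant of any norm,
  which contradicts \<open>interpolating\<close>.\<close>

lemma interpolating_uniform_bound:
  assumes \<alpha>: "0 < \<alpha>" and int: "interpolating \<alpha> L m"
  shows "\<exists>K\<ge>0. \<forall>F. (\<forall>l\<in>L. fock_le \<alpha> 1 (F l)) \<longrightarrow> (\<exists>f. solves \<alpha> L m K F f)"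
proof (rule ccontr)
  assume "\<not> ?thesis"
  then have unb0: "\<exists>F. (\<forall>l\<in>L. fock_le \<alpha> 1 (F l)) \<and> (\<forall>f. \<not> solves \<alpha> L m K F f)" if "0 \<le> K" for K
    using that by blast
  have unb: "\<exists>F. (\<forall>l\<in>L. fock_le \<alpha> 1 (F l)) \<and> (\<forall>f. \<not> solves \<alpha> L m K F f)" for K
    using unb0[of "max 0 K"] solves_mono by (metis max.cobounded1 max.cobounded2)
  \<comment> \<open>The state is a pair: the current data and the radius within which later moves
    must stay.\<close>
  define P where "P = (\<lambda>(n::nat) (p :: (complex \<Rightarrow> complex \<Rightarrow> complex) \<times> real). 0 < snd p \<and> (\<exists>B. \<forall>l\<in>L. fock_le \<alpha> B (fst p l)))"
  define Q where "Q = (\<lambda>n (p :: (complex \<Rightarrow> complex \<Rightarrow> complex) \<times> real) (q :: (complex \<Rightarrow> complex \<Rightarrow> complex) \<times> real). snd q \<le> snd p / 2 \<and>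
    (\<forall>l\<in>L. fock_le \<alpha> (snd p / 2) (\<lambda>z. fst q l z - fst p l z)) \<and>
    (\<forall>G f. (\<forall>l\<in>L. fock_le \<alpha> (snd q) (G l)) \<longrightarrow> \<not> solves \<alpha> L m (real n) (\<lambda>l z. fst q l z + G l z) f))"
  have "\<exists>h. \<forall>n. P n (h n) \<and> Q n (h n) (h (Suc n))"
  proof (rule dependent_nat_choice)
    show "\<exists>p. P 0 p"
      by (rule exI[of _ "(\<lambda>l z. 0, 1)"]) (auto simp: P_def intro!: exI[of _ 0])
    fix p n assume "P n p"
    then obtain B where B: "\<And>l. l \<in> L \<Longrightarrow> fock_le \<alpha> B (fst p l)" and d: "0 < snd p"
      by (auto simp: P_def)
    obtain y d' where y: "0 < d'" "d' \<le> snd p / 2" "\<forall>l\<in>L. fock_le \<alpha> (snd p / 2) (\<lambda>z. y l z - fst p l z)"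
      "\<forall>G f. (\<forall>l\<in>L. fock_le \<alpha> d' (G l)) \<longrightarrow> \<not> solves \<alpha> L m (real n) (\<lambda>l z. y l z + G l z) f"
      using gliding_hump_step[where x = "fst p" and K = "real n", OF \<alpha> unb B d] by blast
    have "fock_le \<alpha> (B + snd p / 2) (y l)" if "l \<in> L" for l
      using fock_le_add[OF B[OF that] bspec[OF y(3) that]] by simp
    then have "P (Suc n) (y, d')" using y(1) unfolding P_def by auto
    moreover have "Q n p (y, d')" using y(2-4) unfolding Q_def by simp
    ultimately show "\<exists>q. P (Suc n) q \<and> Q n p q" by blast
  qed
  then obtain h where P: "\<And>n. P n (h n)" and Q: "\<And>n. Q n (h n) (h (Suc n))" by blast
  define X D where "X = (\<lambda>n. fst (h n))" and "D = (\<lambda>n. snd (h n))"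
  have D: "0 < D n" "D (Suc n) \<le> D n / 2" for n using P[of n] Q[of n] by (auto simp: P_def Q_def D_def)
  have X: "fock_le \<alpha> (D n / 2) (\<lambda>z. X (Suc n) l z - X n l z)" if "l \<in> L" for n l
    using Q[of n] that by (auto simp: Q_def X_def D_def)
  have XX: "fock_le \<alpha> (D n) (\<lambda>z. X k l z - X n l z)" if "n \<le> k" "l \<in> L" for n k l
  proof -
    \<comment> \<open>The steps telescope because
      \<open>D k / 2 \<le> D k - D (Suc k)\<close>.\<close>
    have "fock_le \<alpha> (D n - D k) (\<lambda>z. X k l z - X n l z)"
      using that(1)
    proof (induction k rule: dec_induct)
      case (step k)
      from fock_le_add[OF step.IH X[OF that(2), of k]]
      have "fock_le \<alpha> (D n - D k + D k / 2) (\<lambda>z. X (Suc k) l z - X n l z)" by simp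
      then show ?case by (rule fock_le_mono) (use D(2)[of k] in simp)
    qed simp
    then show ?thesis by (rule fock_le_mono) (use D(1)[of k] in simp)
  qed
  have "\<exists>u. \<forall>n. fock_le \<alpha> (D n) (\<lambda>z. u z - X n l z)" if l: "l \<in> L" for l
  proof -
    \<comment> \<open>The limit comes from normal families: the differences from \<open>X 0\<close>
      are bounded by \<open>D 0\<close>.\<close>
    obtain v r where v: "fock_le \<alpha> (D 0) v" "strict_mono (r :: nat \<Rightarrow> nat)"
      "\<And>z. (\<lambda>n. X (r n) l z - X 0 l z) \<longlonglongrightarrow> v z"
      using fock_Montel[where f = "\<lambda>n z. X n l z - X 0 l z", OF \<alpha> XX[OF _ l]] by auto
    have hX: "X n l holomorphic_on UNIV" for n
      using P[of n] l fock_le_holo by (auto simp: P_def X_def)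
    have "fock_le \<alpha> (D n) (\<lambda>z. (v z + X 0 l z) - X n l z)" for n
    proof (rule fock_le_pointwise_limit[of _ "\<lambda>k z. X (r k) l z - X n l z" n])
      show "(\<lambda>z. (v z + X 0 l z) - X n l z) holomorphic_on UNIV"
        using fock_le_holo[OF v(1)] hX by (intro holomorphic_intros)
      show "(\<lambda>k. X (r k) l z - X n l z) \<longlonglongrightarrow> (v z + X 0 l z) - X n l z" for z
        using tendsto_add[OF v(3)[of z] tendsto_const[of "X 0 l z - X n l z"]] by (simp add: algebra_simps)
      show "fock_le \<alpha> (D n) (\<lambda>z. X (r k) l z - X n l z)" if "n \<le> k" for k
        using that seq_suble[OF v(2), of k] l by (intro XX) auto
    qed
    then show ?thesis by (intro exI[of _ "\<lambda>z. v z + X 0 l z"]) blast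
  qed
  then obtain y where y: "\<And>l n. l \<in> L \<Longrightarrow> fock_le \<alpha> (D n) (\<lambda>z. y l z - X n l z)" by metis
  obtain B where B: "\<And>l. l \<in> L \<Longrightarrow> fock_le \<alpha> B (X 0 l)"
    using P[of 0] by (auto simp: P_def X_def)
  \<comment> \<open>\<open>max 0\<close> keeps the bound nonnegative when \<open>L\<close> is empty
    and \<open>B\<close> is arbitrary.\<close>
  have "fock_le \<alpha> (max 0 (B + D 0)) (y l)" if "l \<in> L" for l
    using fock_le_add[OF B[OF that] y[OF that, of 0]] by (auto intro: fock_le_mono)
  then obtain K f where f: "solves \<alpha> L m K y f"
    using interpolating_solvable[OF int] by (metis max.cobounded1)
  obtain n :: nat where "K \<le> real n" using real_arch_simple by blast
  with f have "solves \<alpha> L m (real n) y f" by (rule solves_mono)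
  moreover have "\<forall>G f. (\<forall>l\<in>L. fock_le \<alpha> (D (Suc n)) (G l)) \<longrightarrow>
      \<not> solves \<alpha> L m (real n) (\<lambda>l z. X (Suc n) l z + G l z) f"
    using Q[of n] by (auto simp: Q_def X_def D_def)
  from this[rule_format, of "\<lambda>l z. y l z - X (Suc n) l z" f] y
  have "\<not> solves \<alpha> L m (real n) y f" by simp
  ultimately show False by blast
qed

text \<open>The uniform bound shows that the set defining the constant is nonempty, so its elements
  come arbitrarily close to the infimum. The absolute value and \<open>+ 1\<close> give a strict
  upper bound whatever the sign.\<close>

lemma interpolation_constant_approx:
  assumes \<alpha>: "0 < \<alpha>" and int: "interpolating \<alpha> L m"
  obtains K where "0 \<le> K" "K < \<bar>interpolation_constant \<alpha> L m\<bar> + 1"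
    "\<And>F. admissible_data \<alpha> L m F \<Longrightarrow> \<exists>f. solves \<alpha> L m (K * data_norm \<alpha> L m F) F f"
proof -
  define S where "S = {K. 0 \<le> K \<and> (\<forall>F. admissible_data \<alpha> L m F \<longrightarrow>
        (\<exists>f. interpolates \<alpha> L m F f \<and> fock_norm \<alpha> f \<le> K * data_norm \<alpha> L m F))}"
  obtain K where K: "0 \<le> K" "\<forall>F. (\<forall>l\<in>L. fock_le \<alpha> 1 (F l)) \<longrightarrow> (\<exists>f. solves \<alpha> L m K F f)"
    using interpolating_uniform_bound[OF \<alpha> int] by blast
  have "\<exists>f. interpolates \<alpha> L m F f \<and> fock_norm \<alpha> f \<le> (2 * K) * data_norm \<alpha> L m F"
    if F: "admissible_data \<alpha> L m F" for F
  proof -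
    define N where "N = data_norm \<alpha> L m F"
    have N: "0 \<le> N" unfolding N_def by (rule data_norm_nonneg[OF F])
    have F': "F l \<in> fock_space \<alpha>" if "l \<in> L" for l using F that by (simp add: admissible_data_def)
    have "\<exists>f. solves \<alpha> L m (2 * K * N) F f"
    proof (cases "N = 0")
      \<comment> \<open>Data of norm 0 cannot be normalised, and a solution of bound exactly 0 is
        required. It arises as a limit, with representatives of norm at most
        \<open>1 / (n + 1)\<close> as the errors.\<close>
      case True
      have "\<exists>G. \<forall>l\<in>L. fock_le \<alpha> (inverse (real (Suc n))) (G l) \<and> vanishes_to (\<lambda>z. F l z - G l z) l (m l)" for n
        by (rule admissible_data_representatives[OF F]) (use True in \<open>simp add: N_def\<close>)
      then obtain G where G: "\<And>n l. l \<in> L \<Longrightarrow> fock_le \<alpha> (inverse (real (Suc n))) (G n l)"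
        "\<And>n l. l \<in> L \<Longrightarrow> vanishes_to (\<lambda>z. F l z - G n l z) l (m l)" by metis
      obtain g where "fock_le \<alpha> 0 g" "\<And>l. l \<in> L \<Longrightarrow> vanishes_to (\<lambda>z. g z - F l z) l (m l)"
      proof (rule interpolants_limit[where \<alpha> = \<alpha> and K = 0 and f = "\<lambda>n z. 0" and L = L and F = F and m = m
            and b = "\<lambda>n. inverse (real (Suc n))" and H = G])
        show "F l holomorphic_on UNIV" if "l \<in> L" for l
          using F'[OF that] by (simp add: fock_space_def)
        show "\<forall>\<^sub>F n in sequentially. vanishes_to (\<lambda>z. 0 + G n l z - F l z) l (m l)" if "l \<in> L" for l
          using vanishes_to_cmult[OF G(2)[OF that], of "-1"] by simp
      qed (use \<alpha> G LIMSEQ_inverse_real_of_nat in auto)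
      then show ?thesis using True by (auto simp: solves_def)
    next
      case False
      with N have N0: "0 < N" by simp
      \<comment> \<open>The factor 2 creates the strict inequality under which representatives
        exist; the rest is scaling to the unit ball and back.\<close>
      obtain G where G: "\<And>l. l \<in> L \<Longrightarrow> fock_le \<alpha> (2 * N) (G l)"
        "\<And>l. l \<in> L \<Longrightarrow> vanishes_to (\<lambda>z. F l z - G l z) l (m l)"
        using admissible_data_representatives[OF F, of "2 * N"] N0 by (auto simp: N_def)
      have "fock_le \<alpha> 1 (\<lambda>z. of_real (1 / (2 * N)) * G l z)" if "l \<in> L" for l
        using fock_le_cmult[OF G(1)[OF that], of "of_real (1 / (2 * N))"] N0 by (simp add: norm_divide)
      then obtain f where f: "solves \<alpha> L m K (\<lambda>l z. of_real (1 / (2 * N)) * G l z) f"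
        using K(2) by meson
      have "solves \<alpha> L m 0 (\<lambda>l z. 0) (\<lambda>z. 0)" by (simp add: solves_def vanishes_to_0)
      from solves_lincomb[OF f this, of "of_real (2 * N)"] N0
      have "solves \<alpha> L m (2 * K * N) G (\<lambda>z. of_real (2 * N) * f z)"
        by (simp add: norm_mult mult_ac)
      from solves_equivalent_data[OF this G(2)] show ?thesis by blast
    qed
    then show ?thesis using solves_interpolates F' unfolding N_def by blast
  qed
  then have "2 * K \<in> S" using K(1) by (simp add: S_def)
  moreover have "bdd_below S" by (rule bdd_belowI[of _ 0]) (simp add: S_def)
  moreover have "interpolation_constant \<alpha> L m = Inf S" by (simp add: S_def interpolation_constant_def)
  ultimately have "\<exists>K\<in>S. K < \<bar>interpolation_constant \<alpha> L m\<bar> + 1"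
    by (subst cInf_less_iff[symmetric]) auto
  then obtain K' where K': "K' \<in> S" "K' < \<bar>interpolation_constant \<alpha> L m\<bar> + 1" by blast
  show ?thesis
  proof (rule that[OF _ K'(2)])
    show "0 \<le> K'" using K'(1) by (simp add: S_def)
    show "\<exists>f. solves \<alpha> L m (K' * data_norm \<alpha> L m F) F f" if "admissible_data \<alpha> L m F" for F
      using K'(1) that interpolates_solves unfolding S_def by blast
  qed
qed

section \<open>The two implications\<close>

text \<open>At a common point both \<open>f\<close> and \<open>f - F l\<close> shrink by
  \<open>exp (- (\<alpha> * c\<^sup>2 / 2))\<close> while \<open>F l\<close> does not, which forces
  \<open>exp (\<alpha> * c\<^sup>2 / 2) \<le> 2 * K + 1\<close>. Discs of nonpositive radius are
  empty, so all of \<open>L\<close> can be treated.\<close>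

lemma interpolating_imp_disjoint:
  assumes \<alpha>: "0 < \<alpha>" and div: "divisor L m" and int: "interpolating \<alpha> L m"
    and c: "0 \<le> c" "2 * \<bar>interpolation_constant \<alpha> L m\<bar> + 3 \<le> exp (\<alpha> * c\<^sup>2 / 2)"
  shows "disjoint_family_on (\<lambda>l. ball l (sqrt (real (m l) / \<alpha>) - c)) L"
  unfolding disjoint_family_on_def
proof (intro ballI impI, rule ccontr)
  fix l k assume lk: "l \<in> L" "k \<in> L" "l \<noteq> k"
    and "ball l (sqrt (real (m l) / \<alpha>) - c) \<inter> ball k (sqrt (real (m k) / \<alpha>) - c) \<noteq> {}"
  then obtain z where "z \<in> ball l (sqrt (real (m l) / \<alpha>) - c)" "z \<in> ball k (sqrt (real (m k) / \<alpha>) - c)"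
    by blast
  then have z: "dist z l \<le> sqrt (real (m l) / \<alpha>) - c" "dist z k \<le> sqrt (real (m k) / \<alpha>) - c"
    by (simp_all add: dist_commute)
  \<comment> \<open>The kernel is centred at the common point \<open>z\<close>, not at
    \<open>l\<close>, so that its weighted size there is 1.\<close>
  define F where "F = (\<lambda>j. if j = l then fock_kernel \<alpha> z else (\<lambda>w. 0))"
  have F: "fock_le \<alpha> 1 (F j)" for j by (simp add: F_def fock_le_fock_kernel \<alpha>)
  obtain K where K: "0 \<le> K" "K < \<bar>interpolation_constant \<alpha> L m\<bar> + 1"
    "\<And>F. admissible_data \<alpha> L m F \<Longrightarrow> \<exists>f. solves \<alpha> L m (K * data_norm \<alpha> L m F) F f"
    using interpolation_constant_approx[OF \<alpha> int, where thesis = thesis] by blast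
  have adm: "admissible_data \<alpha> L m F" "data_norm \<alpha> L m F \<le> 1"
    using admissible_dataI[of L \<alpha> 1 F m] F by auto
  obtain f where "solves \<alpha> L m (K * data_norm \<alpha> L m F) F f" using K(3)[OF adm(1)] by blast
  then have "solves \<alpha> L m K F f"
    by (rule solves_mono) (use K(1) adm(2) in \<open>simp add: mult_left_le\<close>)
  then have f: "fock_le \<alpha> K f" "vanishes_to (\<lambda>w. f w - F l w) l (m l)" "vanishes_to (\<lambda>w. f w - F k w) k (m k)"
    using lk by (auto simp: solves_def)
  have m: "1 \<le> m l" "1 \<le> m k" using div lk by (auto simp: divisor_def)
  define E where "E = exp (\<alpha> / 2 * (norm z)\<^sup>2)"
  define \<epsilon> where "\<epsilon> = exp (- (\<alpha> * c\<^sup>2 / 2))"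
  have "vanishes_to f k (m k)" using f(3) lk(3) by (simp add: F_def)
  from fock_decay_near_zero[OF \<alpha> f(1) this m(2) z(2) c(1)]
  have 1: "norm (f z) \<le> K * E * \<epsilon>" by (simp add: E_def \<epsilon>_def)
  have "norm (f z - F l z) \<le> (K + 1) * E * \<epsilon>"
    unfolding E_def \<epsilon>_def
    by (rule fock_decay_near_zero[OF \<alpha> fock_le_diff[OF f(1) F] f(2) m(1) z(1) c(1)])
  moreover have "norm (F l z) = E" by (simp add: F_def norm_fock_kernel E_def)
  moreover have "norm (F l z) \<le> norm (f z) + norm (f z - F l z)"
    using norm_triangle_ineq4[of "f z" "f z - F l z"] by simp
  ultimately have "E \<le> K * E * \<epsilon> + (K + 1) * E * \<epsilon>" using 1 by linarith
  then have "E * 1 \<le> E * ((2 * K + 1) * \<epsilon>)" by (simp add: algebra_simps)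
  then have "1 \<le> (2 * K + 1) * \<epsilon>" by (simp add: E_def)
  then have "exp (\<alpha> * c\<^sup>2 / 2) \<le> 2 * K + 1" by (simp add: \<epsilon>_def exp_minus field_simps)
  with c(2) K(2) show False by linarith
qed

lemma disjoint_imp_interpolating:
  assumes \<alpha>: "0 < \<alpha>" and div: "divisor L m" and C: "2 \<le> sqrt \<alpha> * C"
    and C_large: "exp (- (sqrt \<alpha> * C)\<^sup>2 / 16) * lattice_const \<le> \<delta>"
      "\<delta> \<le> 1" "local_const * local_const * \<delta> \<le> 1 / 2"
    and disj: "disjoint_family_on (\<lambda>l. ball l (sqrt (m l / \<alpha>) + C)) L"
  shows "interpolating \<alpha> L m"
  unfolding interpolating_def
proof (intro allI impI)
  fix F assume F: "admissible_data \<alpha> L m F"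
  \<comment> \<open>The \<open>+ 1\<close> gives the strict inequality needed to choose
    representatives of norm at most \<open>B\<close>.\<close>
  define B where "B = data_norm \<alpha> L m F + 1"
  have B: "0 \<le> B" using data_norm_nonneg[OF F] by (simp add: B_def)
  obtain G where G: "\<And>l. l \<in> L \<Longrightarrow> fock_le \<alpha> B (G l)"
    "\<And>l. l \<in> L \<Longrightarrow> vanishes_to (\<lambda>z. F l z - G l z) l (m l)"
    using admissible_data_representatives[OF F, of B] by (auto simp: B_def)
  have L: "countable L" and m: "\<And>l. l \<in> L \<Longrightarrow> 1 \<le> m l" using div by (auto simp: divisor_def)
  obtain f where "fock_le \<alpha> (4 * local_const * B) f"
    "\<And>l. l \<in> L \<Longrightarrow> vanishes_to (\<lambda>z. f z - G l z) l (m l)"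
    using separated_interpolation[where m = m and G = G and \<epsilon> = B and thesis = thesis,
        OF \<alpha> L C C_large m disj G(1) B] by blast
  then have "solves \<alpha> L m (4 * local_const * B) G f" by (simp add: solves_def)
  then have "solves \<alpha> L m (4 * local_const * B) F f" by (rule solves_equivalent_data[OF _ G(2)])
  moreover have "\<And>l. l \<in> L \<Longrightarrow> F l \<in> fock_space \<alpha>" using F by (simp add: admissible_data_def)
  ultimately show "\<exists>f. interpolates \<alpha> L m F f" using solves_interpolates(1) by blast
qed

theorem theorem1p6:
  fixes \<alpha> :: real
  assumes "\<alpha> > 0"
  shows "(\<exists>C :: real \<Rightarrow> real. (\<forall>M. C M > 0) \<and>
           (\<forall>(\<Lambda> :: complex set) (m :: complex \<Rightarrow> nat).
              divisor \<Lambda> m \<longrightarrow> interpolating \<alpha> \<Lambda> m \<longrightarrow>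
              (let c = C (interpolation_constant \<alpha> \<Lambda> m) in
                 disjoint_family_on (\<lambda>l. ball l (sqrt (real (m l) / \<alpha>) - c))
                   {l \<in> \<Lambda>. real (m l) > \<alpha> * c\<^sup>2})))
       \<and> (\<exists>C0 :: real. C0 > 0 \<and>
           (\<forall>(\<Lambda> :: complex set) (m :: complex \<Rightarrow> nat).
              divisor \<Lambda> m \<longrightarrow>
              disjoint_family_on (\<lambda>l. ball l (sqrt (real (m l) / \<alpha>) + C0)) \<Lambda> \<longrightarrow>
              interpolating \<alpha> \<Lambda> m))"
proof
  \<comment> \<open>\<open>C M\<close> is the positive solution \<open>c\<close> of
    \<open>exp (\<alpha> * c\<^sup>2 / 2) = 2 * |M| + 3\<close>.\<close>
  define C where "C = (\<lambda>M::real. sqrt (2 * ln (2 * \<bar>M\<bar> + 3) / \<alpha>))"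
  have pos: "0 < 2 * ln (2 * \<bar>M\<bar> + 3) / \<alpha>" for M :: real
    using assms by (intro divide_pos_pos mult_pos_pos ln_gt_zero) auto
  have C: "0 < C M" "2 * \<bar>M\<bar> + 3 \<le> exp (\<alpha> * (C M)\<^sup>2 / 2)" for M
    using pos[of M] assms by (auto simp: C_def)
  show "\<exists>C :: real \<Rightarrow> real. (\<forall>M. C M > 0) \<and>
           (\<forall>(\<Lambda> :: complex set) (m :: complex \<Rightarrow> nat).
              divisor \<Lambda> m \<longrightarrow> interpolating \<alpha> \<Lambda> m \<longrightarrow>
              (let c = C (interpolation_constant \<alpha> \<Lambda> m) in
                 disjoint_family_on (\<lambda>l. ball l (sqrt (real (m l) / \<alpha>) - c))
                   {l \<in> \<Lambda>. real (m l) > \<alpha> * c\<^sup>2}))"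
    unfolding Let_def
  proof (intro exI[of _ C] conjI allI impI C(1))
    fix \<Lambda> :: "complex set" and m :: "complex \<Rightarrow> nat"
    assume d: "divisor \<Lambda> m" "interpolating \<alpha> \<Lambda> m"
    let ?c = "C (interpolation_constant \<alpha> \<Lambda> m)"
    have "disjoint_family_on (\<lambda>l. ball l (sqrt (real (m l) / \<alpha>) - ?c)) \<Lambda>"
      using interpolating_imp_disjoint[OF assms d less_imp_le[OF C(1)] C(2)] .
    then show "disjoint_family_on (\<lambda>l. ball l (sqrt (real (m l) / \<alpha>) - ?c))
        {l \<in> \<Lambda>. real (m l) > \<alpha> * ?c\<^sup>2}"
      by (rule disjoint_family_on_mono[rotated]) auto
  qed
  \<comment> \<open>Small enough that each correction pass halves the residual.\<close>
  define \<delta> where "\<delta> = min 1 (1 / (2 * (local_const * local_const)))"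
  have \<delta>: "0 < \<delta>" "\<delta> \<le> 1" using local_const_pos by (auto simp: \<delta>_def)
  have "local_const * local_const * \<delta> \<le> local_const * local_const * (1 / (2 * (local_const * local_const)))"
    using local_const_pos by (intro mult_left_mono) (auto simp: \<delta>_def)
  then have \<delta>': "local_const * local_const * \<delta> \<le> 1 / 2" using local_const_pos by simp
  \<comment> \<open>\<open>x\<close> is \<open>sqrt \<alpha>\<close> times the radius increment
    \<open>C0\<close>. The summand 16 gives \<open>x \<le> x\<^sup>2 / 16\<close>, and the other
    gives \<open>lattice_const \<le> \<delta> * x\<close>.\<close>
  define x where "x = 16 + lattice_const / \<delta>"
  have lat: "0 \<le> lattice_const" by (simp add: lattice_const_def)
  have x: "16 \<le> x" using \<delta>(1) lat by (simp add: x_def)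
  have "lattice_const \<le> \<delta> * x" using \<delta>(1) by (simp add: x_def algebra_simps)
  also have "\<dots> \<le> \<delta> * (1 + x\<^sup>2 / 16)"
  proof (rule mult_left_mono)
    have "16 * x \<le> x * x" using x by (intro mult_right_mono) auto
    then show "x \<le> 1 + x\<^sup>2 / 16" by (simp add: power2_eq_square)
  qed (use \<delta>(1) in simp)
  also have "\<dots> \<le> \<delta> * exp (x\<^sup>2 / 16)" using \<delta>(1) exp_ge_add_one_self by (intro mult_left_mono) auto
  finally have large: "exp (- x\<^sup>2 / 16) * lattice_const \<le> \<delta>" by (simp add: exp_minus field_simps)
  have sx: "sqrt \<alpha> * (x / sqrt \<alpha>) = x" using assms by simp
  show "\<exists>C0 :: real. C0 > 0 \<and>
           (\<forall>(\<Lambda> :: complex set) (m :: complex \<Rightarrow> nat).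
              divisor \<Lambda> m \<longrightarrow>
              disjoint_family_on (\<lambda>l. ball l (sqrt (real (m l) / \<alpha>) + C0)) \<Lambda> \<longrightarrow>
              interpolating \<alpha> \<Lambda> m)"
  proof (intro exI[of _ "x / sqrt \<alpha>"] conjI allI impI)
    show "0 < x / sqrt \<alpha>" using x assms by simp
    fix \<Lambda> :: "complex set" and m :: "complex \<Rightarrow> nat"
    assume d: "divisor \<Lambda> m" "disjoint_family_on (\<lambda>l. ball l (sqrt (real (m l) / \<alpha>) + x / sqrt \<alpha>)) \<Lambda>"
    show "interpolating \<alpha> \<Lambda> m"
    proof (rule disjoint_imp_interpolating[OF assms d(1) _ _ \<delta>(2) \<delta>' d(2)])
      show "2 \<le> sqrt \<alpha> * (x / sqrt \<alpha>)" unfolding sx using x by simp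
      show "exp (- (sqrt \<alpha> * (x / sqrt \<alpha>))\<^sup>2 / 16) * lattice_const \<le> \<delta>" unfolding sx by (rule large)
    qed
  qed
qed

end
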